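(* Let $m\ge 1$ and let $a_m(\mathcal{L}_n)$ be the number of subgroups of $\mathcal{L}_n$ of index $m$. Then $$a_m(\mathcal{L}_n)=\sum_{t\ge 0:\,p^t\mid m}b_t\!\left(R^{\,nm/p^t}\right)p^t=\sum_{t\ge 1:\,p^t\mid m}\left(p^{\frac{nmt}{p^t}}-p^{\frac{nm(t-1)}{p^t}}\right)p^t+1 .$$
   Context: $p$ is a fixed prime, $n\ge 1$, $R=\mathbb{F}_p[x,x^{-1}]$. $\mathcal{L}_n=(\mathbb{Z}/p\mathbb{Z})^n\wr\mathbb{Z}=\left(\bigoplus_{\mathbb{Z}}(\mathbb{Z}/p\mathbb{Z})^n\right)\rtimes\mathbb{Z}$, where the generator of $\mathbb{Z}$ acts by the shift by one. For $k\ge 1$ and $t\ge 0$, $b_t(R^k)$ denotes the number of $R$-submodules $M\subset R^k$ with $\dim_{\mathbb{F}_p}R^k/M=t$. *)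

theory Defs
  imports
    "HOL-Algebra.Product_Groups"
    "HOL-Library.Poly_Mapping"
    "Jordan_Normal_Form.VS_Connect"
    "Berlekamp_Zassenhaus.Finite_Field"
begin

definition semidirect_product ::
  "('a, 'c) monoid_scheme \<Rightarrow> ('b, 'd) monoid_scheme \<Rightarrow> ('b \<Rightarrow> 'a \<Rightarrow> 'a) \<Rightarrow> ('a \<times> 'b) monoid"
  where "semidirect_product N H \<phi> =
    \<lparr>carrier = carrier N \<times> carrier H,
     monoid.mult = (\<lambda>(a, g) (b, h). (a \<otimes>\<^bsub>N\<^esub> \<phi> g b, g \<otimes>\<^bsub>H\<^esub> h)),
     one = (\<one>\<^bsub>N\<^esub>, \<one>\<^bsub>H\<^esub>)\<rparr>"

definition shift :: "int \<Rightarrow> (int \<Rightarrow> 'a) \<Rightarrow> (int \<Rightarrow> 'a)"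
  where "shift s f = (\<lambda>i. f (i - s))"

definition lamplighter :: "nat \<Rightarrow> nat \<Rightarrow> ((int \<Rightarrow> nat \<Rightarrow> int) \<times> int) monoid"
  where "lamplighter p n =
    semidirect_product
      (sum_group (UNIV :: int set) (\<lambda>_. product_group {..<n} (\<lambda>_. integer_mod_group p)))
      integer_group
      shift"

definition num_subgroups :: "('a, 'b) monoid_scheme \<Rightarrow> nat \<Rightarrow> nat"
  where "num_subgroups G m = card {H. subgroup H G \<and> finite (rcosets\<^bsub>G\<^esub> H) \<and> card (rcosets\<^bsub>G\<^esub> H) = m}"

text \<open>Finitely supported functions on the integers with the convolution product: the function
  \<open>f\<close> is the Laurent polynomial whose coefficient at \<open>x\<^sup>i\<close> is \<open>lookup f i\<close>. The field
  of \<open>p\<close> elements is \<^typ>\<open>'p mod_ring\<close> with \<open>p = CARD('p)\<close> prime.\<close>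

type_synonym 'p laurent = "int \<Rightarrow>\<^sub>0 'p mod_ring"

definition restrict_scalars :: "('c \<Rightarrow> 'a) \<Rightarrow> ('a, 'b) module \<Rightarrow> ('c, 'b) module"
  where "restrict_scalars h V =
    \<lparr>carrier = carrier V, monoid.mult = monoid.mult V, one = one V,
     zero = zero V, add = add V, module.smult = (\<lambda>c v. h c \<odot>\<^bsub>V\<^esub> v)\<rparr>"

text \<open>As in \<^const>\<open>module_vec\<close>, the multiplicative part of the record is irrelevant. The union in the
  scalar action is over cosets that all coincide.\<close>

definition quotient_module :: "('a, 'b) module \<Rightarrow> 'b set \<Rightarrow> ('a, 'b set) module"
  where "quotient_module V M =
    \<lparr>carrier = a_rcosets\<^bsub>V\<^esub> M, monoid.mult = undefined, one = undefined,
     zero = M, add = set_add V,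
     module.smult = (\<lambda>c X. \<Union>v\<in>X. M +>\<^bsub>V\<^esub> (c \<odot>\<^bsub>V\<^esub> v))\<rparr>"

definition has_dimension :: "('a, 'c) ring_scheme \<Rightarrow> ('a, 'b, 'd) module_scheme \<Rightarrow> nat \<Rightarrow> bool"
  where "has_dimension K V t \<longleftrightarrow> vectorspace.fin_dim K V \<and> vectorspace.dim K V = t"

abbreviation laurent_space :: "'p::prime_card itself \<Rightarrow> nat \<Rightarrow> ('p laurent, 'p laurent vec) module"
  where "laurent_space _ k \<equiv> module_vec TYPE('p laurent) k"

definition num_submodules :: "'p::prime_card itself \<Rightarrow> nat \<Rightarrow> nat \<Rightarrow> nat"
  where "num_submodules ty t k =
    card {M. submodule (class_ring :: 'p laurent ring) M (laurent_space ty k) \<and>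
             has_dimension (class_ring :: 'p mod_ring ring)
               (restrict_scalars (Poly_Mapping.single 0)
                 (quotient_module (laurent_space ty k) M)) t}"

end

theory Submission
  imports Defs "HOL-Library.Function_Algebras"
begin

text \<open>A subgroup \<open>H\<close> of finite index in a semidirect product \<open>A \<rtimes> \<int>\<close> with \<open>A\<close> abelian is determined by its
  image \<open>d\<int>\<close>, its intersection \<open>M\<close> with \<open>A\<close>, which is invariant under the action of \<open>d\<close>, and the coset
  of \<open>M\<close> formed by the \<open>a\<close> with \<open>(a, d) \<in> H\<close>; its index is \<open>d * [A : M]\<close>. For the lamplighter group, \<open>A\<close> with the shift by
  \<open>d\<close> is the module \<open>R ^ (n * d)\<close> over the Laurent polynomials. The same argument applied to \<open>R ^ k \<times> R\<close>
  gives \<open>b t (R ^ (k + 1)) = (\<Sum>i\<le>t. b i (R ^ k) * p ^ i * b (t - i) R)\<close>, because a nonzero ideal of \<open>R\<close> is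
  free on one generator, and the ideals of finite index correspond to the monic polynomials with nonzero
  constant coefficient.\<close>

section \<open>Cosets and homomorphisms\<close>

text \<open>The factor \<open>p ^ t\<close> in the formula is the number of cosets of
  \<open>M\<close> when \<open>[A : M] = p ^ t\<close>, that is when \<open>d = m / p ^ t\<close>.
  That no other index occurs for submodules of \<open>R ^ k\<close> comes out of the same induction
  that counts them. Both fibre counts rest on one principle: an extension by something free on one
  generator (\<open>d Z\<close> as a group, \<open>R a\<close> as a module) is fixed by a lift of
  that generator, and the lift may be chosen freely modulo the kernel. The number of choices is
  therefore an index, independent of the generator. All indices are \<open>card\<close> of a set of
  cosets, so an infinite index reads as 0. The product formula for indices survives this convention,
  and a positive index already carries finiteness; dimensions are replaced by cardinalities for the
  same reason.\<close>

lemma rcosets_eq_iff: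
  assumes "group G" "subgroup H G" "x \<in> carrier G" "y \<in> carrier G"
  shows "H #>\<^bsub>G\<^esub> x = H #>\<^bsub>G\<^esub> y \<longleftrightarrow> x \<otimes>\<^bsub>G\<^esub> inv\<^bsub>G\<^esub> y \<in> H"
  using assms by (metis group.rcos_self group.repr_independence subgroup.rcos_module)

text \<open>Used to carry submodules from vectors to coordinate functions and from there to the
  lamplighter base; the properties \<open>P\<close> and \<open>P'\<close> hold the extra invariance
  and the index.\<close>

lemma bij_betw_subgroups_iso:
  assumes iso: "\<phi> \<in> iso G G'" and "group G" "group G'"
    and P: "\<And>M. subgroup M G \<Longrightarrow> P M \<longleftrightarrow> P' (\<phi> ` M)"
  shows "bij_betw ((`) \<phi>) {M. subgroup M G \<and> P M} {M. subgroup M G' \<and> P' M}"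
proof -
  interpret \<phi>: group_hom G G' \<phi>
    using assms by (simp add: group_hom_def group_hom_axioms_def iso_def)
  have inj: "inj_on \<phi> (carrier G)" and img: "\<phi> ` carrier G = carrier G'"
    using iso by (auto simp: iso_def bij_betw_def)
  define \<psi> where "\<psi> = inv_into (carrier G) \<phi>"
  have \<psi>: "\<psi> \<in> iso G' G"
    unfolding \<psi>_def using group.iso_set_sym[OF \<open>group G\<close> iso] .
  interpret \<psi>: group_hom G' G \<psi>
    using assms \<psi> by (simp add: group_hom_def group_hom_axioms_def iso_def)
  show ?thesis
  proof (rule bij_betwI[of _ _ _ "(`) \<psi>"])
    have "\<psi> ` \<phi> ` M = M" if "subgroup M G" for M
      using inj subgroup.subset[OF that] unfolding \<psi>_def by simp
    then show "\<psi> ` \<phi> ` M = M" if "M \<in> {M. subgroup M G \<and> P M}" for M using that by blast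
    have *: "\<phi> ` \<psi> ` M = M" if "subgroup M G'" for M
      using img subgroup.subset[OF that] unfolding \<psi>_def by (simp add: image_inv_into_cancel)
    then show "\<phi> ` \<psi> ` M = M" if "M \<in> {M. subgroup M G' \<and> P' M}" for M using that by blast
    show "(`) \<phi> \<in> {M. subgroup M G \<and> P M} \<rightarrow> {M. subgroup M G' \<and> P' M}"
      using P \<phi>.subgroup_img_is_subgroup by auto
    show "(`) \<psi> \<in> {M. subgroup M G' \<and> P' M} \<rightarrow> {M. subgroup M G \<and> P M}"
      using P * \<psi>.subgroup_img_is_subgroup by auto
  qed
qed

lemma card_rcosets_iso:
  assumes iso: "\<phi> \<in> iso G G'" and H: "H \<subseteq> carrier G"
    and G: "group G"
  shows "card (rcosets\<^bsub>G'\<^esub> (\<phi> ` H)) = card (rcosets\<^bsub>G\<^esub> H)"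
proof -
  have inj: "inj_on \<phi> (carrier G)" and img: "\<phi> ` carrier G = carrier G'" and hom: "\<phi> \<in> hom G G'"
    using iso by (auto simp: iso_def bij_betw_def)
  have coset: "(\<phi> ` H) #>\<^bsub>G'\<^esub> \<phi> a = \<phi> ` (H #>\<^bsub>G\<^esub> a)" if "a \<in> carrier G" for a
    using that H hom_mult[OF hom] by (force simp: r_coset_def image_iff)
  have "rcosets\<^bsub>G'\<^esub> (\<phi> ` H) = (`) \<phi> ` (rcosets\<^bsub>G\<^esub> H)"
    using coset by (auto simp: RCOSETS_def img[symmetric])
  moreover have "inj_on ((`) \<phi>) (rcosets\<^bsub>G\<^esub> H)"
  proof (rule inj_on_subset[OF inj_on_image_Pow[OF inj]])
    show "rcosets\<^bsub>G\<^esub> H \<subseteq> Pow (carrier G)"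
      using monoid.r_coset_subset_G[OF group.is_monoid[OF G] H] by (auto simp: RCOSETS_def)
  qed
  ultimately show ?thesis by (simp add: card_image)
qed

text \<open>A coset of \<open>H\<close> is determined by its image in \<open>Q\<close> and, once a
  lift of that image is fixed, by a coset of the trace of \<open>H\<close> on the kernel. Since this
  is an explicit bijection, the product formula also holds when an infinite index reads as
  0.\<close>

lemma card_rcosets_hom:
  assumes "group_hom G Q h" and surj: "h ` carrier G = carrier Q" and H: "subgroup H G"
  defines "K \<equiv> kernel G Q h"
  shows "card (rcosets\<^bsub>G\<^esub> H) =
    card (rcosets\<^bsub>G\<lparr>carrier := K\<rparr>\<^esub> (H \<inter> K)) * card (rcosets\<^bsub>Q\<^esub> (h ` H))"
proof -
  interpret h: group_hom G Q h by fact
  have hH: "subgroup (h ` H) Q" by (rule h.subgroup_img_is_subgroup[OF H])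
  have K: "subgroup K G" unfolding K_def by (rule h.subgroup_kernel)
  have KH: "subgroup (H \<inter> K) G" by (rule h.G.subgroups_Inter_pair[OF H K])
  have Kmem: "a \<in> K \<longleftrightarrow> a \<in> carrier G \<and> h a = \<one>\<^bsub>Q\<^esub>" for a by (auto simp: K_def kernel_def)
  have Hsub: "H \<subseteq> carrier G" by (rule subgroup.subset[OF H])
  define s where "s D = (SOME g. g \<in> carrier G \<and> D = h ` H #>\<^bsub>Q\<^esub> h g)" for D
  have s: "s D \<in> carrier G" "D = h ` H #>\<^bsub>Q\<^esub> h (s D)" if "D \<in> rcosets\<^bsub>Q\<^esub> (h ` H)" for D
  proof -
    from that obtain x where "x \<in> h ` carrier G" "D = h ` H #>\<^bsub>Q\<^esub> x"
      unfolding surj by (auto simp: RCOSETS_def)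
    then have "\<exists>g. g \<in> carrier G \<and> D = h ` H #>\<^bsub>Q\<^esub> h g" by blast
    from someI_ex[OF this] show "s D \<in> carrier G" "D = h ` H #>\<^bsub>Q\<^esub> h (s D)" by (auto simp: s_def)
  qed
  define r where "r C = (SOME a. a \<in> K \<and> C = (H \<inter> K) #>\<^bsub>G\<^esub> a)" for C
  have r: "r C \<in> K" "C = (H \<inter> K) #>\<^bsub>G\<^esub> r C" if "C \<in> rcosets\<^bsub>G\<lparr>carrier := K\<rparr>\<^esub> (H \<inter> K)" for C
  proof -
    from that have "\<exists>a. a \<in> K \<and> C = (H \<inter> K) #>\<^bsub>G\<^esub> a" by (auto simp: RCOSETS_def)
    from someI_ex[OF this] show "r C \<in> K" "C = (H \<inter> K) #>\<^bsub>G\<^esub> r C" by (auto simp: r_def)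
  qed
  \<comment> \<open>With \<open>r\<close> and \<open>s\<close> choosing representatives, every coset
    of \<open>H\<close> is hit exactly once by a kernel element times a lift.\<close>
  let ?f = "\<lambda>(C, D). H #>\<^bsub>G\<^esub> (r C \<otimes>\<^bsub>G\<^esub> s D)"
  have "bij_betw ?f ((rcosets\<^bsub>G\<lparr>carrier := K\<rparr>\<^esub> (H \<inter> K)) \<times> (rcosets\<^bsub>Q\<^esub> (h ` H))) (rcosets\<^bsub>G\<^esub> H)"
  proof (rule bij_betw_imageI)
    show "inj_on ?f ((rcosets\<^bsub>G\<lparr>carrier := K\<rparr>\<^esub> (H \<inter> K)) \<times> (rcosets\<^bsub>Q\<^esub> (h ` H)))"
    proof (rule inj_onI, clarsimp)
      fix C D C' D'
      assume C: "C \<in> rcosets\<^bsub>G\<lparr>carrier := K\<rparr>\<^esub> (H \<inter> K)" "C' \<in> rcosets\<^bsub>G\<lparr>carrier := K\<rparr>\<^esub> (H \<inter> K)"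
        and D: "D \<in> rcosets\<^bsub>Q\<^esub> (h ` H)" "D' \<in> rcosets\<^bsub>Q\<^esub> (h ` H)"
        and eq: "H #>\<^bsub>G\<^esub> (r C \<otimes>\<^bsub>G\<^esub> s D) = H #>\<^bsub>G\<^esub> (r C' \<otimes>\<^bsub>G\<^esub> s D')"
      note m[simp] = r(1)[OF C(1)] r(1)[OF C(2)] s(1)[OF D(1)] s(1)[OF D(2)]
      have [simp]: "r C \<in> carrier G" "r C' \<in> carrier G" "h (r C) = \<one>\<^bsub>Q\<^esub>" "h (r C') = \<one>\<^bsub>Q\<^esub>"
        using m Kmem by blast+
      have mem: "(r C \<otimes>\<^bsub>G\<^esub> s D) \<otimes>\<^bsub>G\<^esub> inv\<^bsub>G\<^esub> (r C' \<otimes>\<^bsub>G\<^esub> s D') \<in> H"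
        using eq rcosets_eq_iff[OF h.G.is_group H] by simp
      then have "h (s D) \<otimes>\<^bsub>Q\<^esub> inv\<^bsub>Q\<^esub> h (s D') \<in> h ` H"
        by (rule rev_image_eqI) (simp add: h.G.inv_mult_group h.H.m_assoc)
      then have DD: "D = D'"
        using rcosets_eq_iff[OF h.H.is_group hH, of "h (s D)" "h (s D')"] s(2)[OF D(1)] s(2)[OF D(2)]
        by simp
      have cancel: "s D \<otimes>\<^bsub>G\<^esub> (inv\<^bsub>G\<^esub> s D \<otimes>\<^bsub>G\<^esub> inv\<^bsub>G\<^esub> r C') = inv\<^bsub>G\<^esub> r C'"
        by (simp add: h.G.m_assoc[symmetric])
      have "r C \<otimes>\<^bsub>G\<^esub> inv\<^bsub>G\<^esub> r C' \<in> H"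
        using mem DD cancel by (simp add: h.G.inv_mult_group h.G.m_assoc)
      moreover have "r C \<otimes>\<^bsub>G\<^esub> inv\<^bsub>G\<^esub> r C' \<in> K" by (simp add: Kmem)
      ultimately have "(H \<inter> K) #>\<^bsub>G\<^esub> r C = (H \<inter> K) #>\<^bsub>G\<^esub> r C'"
        using rcosets_eq_iff[OF h.G.is_group KH] by simp
      then show "C = C' \<and> D = D'" using r(2)[OF C(1)] r(2)[OF C(2)] DD by simp
    qed
    show "?f ` ((rcosets\<^bsub>G\<lparr>carrier := K\<rparr>\<^esub> (H \<inter> K)) \<times> (rcosets\<^bsub>Q\<^esub> (h ` H))) = rcosets\<^bsub>G\<^esub> H"
    proof (intro equalityI subsetI)
      fix X assume "X \<in> ?f ` ((rcosets\<^bsub>G\<lparr>carrier := K\<rparr>\<^esub> (H \<inter> K)) \<times> (rcosets\<^bsub>Q\<^esub> (h ` H)))"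
      then show "X \<in> rcosets\<^bsub>G\<^esub> H"
        using r(1) s(1) Kmem by (auto intro!: h.G.rcosetsI[OF Hsub])
    next
      fix X assume "X \<in> rcosets\<^bsub>G\<^esub> H"
      then obtain g where g: "g \<in> carrier G" "X = H #>\<^bsub>G\<^esub> g" by (auto simp: RCOSETS_def)
      define D where "D = h ` H #>\<^bsub>Q\<^esub> h g"
      have D: "D \<in> rcosets\<^bsub>Q\<^esub> (h ` H)"
        unfolding D_def using g by (intro h.H.rcosetsI subgroup.subset[OF hH]) auto
      have "h g \<otimes>\<^bsub>Q\<^esub> inv\<^bsub>Q\<^esub> h (s D) \<in> h ` H"
        using rcosets_eq_iff[OF h.H.is_group hH, of "h g" "h (s D)"] s[OF D] g D_def by simp
      then obtain u where u: "u \<in> H" "h u = h g \<otimes>\<^bsub>Q\<^esub> inv\<^bsub>Q\<^esub> h (s D)" by auto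
      note [simp] = subsetD[OF Hsub u(1)] g(1) s(1)[OF D]
      \<comment> \<open>So \<open>g\<close> is \<open>u\<close> times \<open>a\<close> times
        \<open>s D\<close>: the factor \<open>u\<close> from \<open>H\<close> and the lift together
        have the image of \<open>g\<close>, which leaves \<open>a\<close> in the kernel.\<close>
      define a where "a = inv\<^bsub>G\<^esub> u \<otimes>\<^bsub>G\<^esub> g \<otimes>\<^bsub>G\<^esub> inv\<^bsub>G\<^esub> s D"
      have ac: "a \<in> carrier G" by (simp add: a_def)
      have aK: "a \<in> K"
        using u(2) by (simp add: Kmem a_def h.H.m_assoc h.H.inv_mult_group)
      define C where "C = (H \<inter> K) #>\<^bsub>G\<^esub> a"
      have C: "C \<in> rcosets\<^bsub>G\<lparr>carrier := K\<rparr>\<^esub> (H \<inter> K)"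
        using aK by (auto simp: C_def RCOSETS_def)
      have rC: "r C \<in> carrier G" using r(1)[OF C] Kmem by blast
      have "r C \<otimes>\<^bsub>G\<^esub> inv\<^bsub>G\<^esub> a \<in> H"
        using rcosets_eq_iff[OF h.G.is_group KH rC ac] r(2)[OF C] C_def by simp
      moreover have "u \<in> H" by fact
      moreover have "(r C \<otimes>\<^bsub>G\<^esub> s D) \<otimes>\<^bsub>G\<^esub> inv\<^bsub>G\<^esub> g = (r C \<otimes>\<^bsub>G\<^esub> inv\<^bsub>G\<^esub> a) \<otimes>\<^bsub>G\<^esub> inv\<^bsub>G\<^esub> u"
        using rC by (simp add: a_def h.G.inv_mult_group h.G.m_assoc)
      ultimately have "(r C \<otimes>\<^bsub>G\<^esub> s D) \<otimes>\<^bsub>G\<^esub> inv\<^bsub>G\<^esub> g \<in> H"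
        using H by (simp add: subgroup.m_closed subgroup.m_inv_closed)
      then have "H #>\<^bsub>G\<^esub> (r C \<otimes>\<^bsub>G\<^esub> s D) = H #>\<^bsub>G\<^esub> g"
        using rcosets_eq_iff[OF h.G.is_group H] rC by simp
      then have "X = ?f (C, D)" using g by simp
      then show "X \<in> ?f ` ((rcosets\<^bsub>G\<lparr>carrier := K\<rparr>\<^esub> (H \<inter> K)) \<times> (rcosets\<^bsub>Q\<^esub> (h ` H)))"
        using C D by blast
    qed
  qed
  then show ?thesis by (metis bij_betw_same_card card_cartesian_product)
qed

section \<open>Polynomials and Laurent polynomials\<close>

text \<open>The inclusion of \<open>k[x]\<close> into \<open>k[x, 1/x]\<close>. It brings degree and
  division with remainder to bear on Laurent polynomials.\<close>

definition laur :: "'k::field poly \<Rightarrow> int \<Rightarrow>\<^sub>0 'k"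
  where "laur q = poly (map_poly (Poly_Mapping.single 0) q) (Poly_Mapping.single 1 1)"

abbreviation xpow :: "int \<Rightarrow> int \<Rightarrow>\<^sub>0 'k::field"
  where "xpow i \<equiv> Poly_Mapping.single i 1"

lemma lookup_single_mult:
  fixes r :: "int \<Rightarrow>\<^sub>0 'k::comm_ring_1"
  shows "Poly_Mapping.lookup (Poly_Mapping.single k c * r) i = c * Poly_Mapping.lookup r (i - k)"
proof -
  have "Sum_any (\<lambda>q. Poly_Mapping.lookup r q when i = l + q) = Poly_Mapping.lookup r (i - l)" for l
  proof -
    have "(\<lambda>q. Poly_Mapping.lookup r q when i = l + q) = (\<lambda>q. Poly_Mapping.lookup r q when q = i - l)"
      by (auto simp: fun_eq_iff when_def)
    then show ?thesis by (simp only: Sum_any_when_equal)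
  qed
  moreover have "(\<lambda>l. (c when k = l) * Poly_Mapping.lookup r (i - l)) = (\<lambda>l. c * Poly_Mapping.lookup r (i - l) when l = k)"
    by (auto simp: fun_eq_iff when_def)
  ultimately show ?thesis by (simp only: lookup_mult lookup_single Sum_any_when_equal)
qed

lemma laur_pCons: "laur (pCons c q) = Poly_Mapping.single 0 c + xpow 1 * laur q"
proof (cases "pCons c q = 0")
  case True
  then show ?thesis by (simp add: laur_def)
next
  case False
  then show ?thesis by (auto simp: laur_def map_poly_pCons)
qed

lemma lookup_laur: "Poly_Mapping.lookup (laur q) i = (if 0 \<le> i then poly.coeff q (nat i) else 0)"
proof (induction q arbitrary: i)
  case 0
  then show ?case by (simp add: laur_def)
next
  case (pCons c q)
  then show ?case
    by (auto simp: laur_pCons lookup_add lookup_single_mult lookup_single when_def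
        coeff_pCons nat_diff_distrib split: nat.splits)
qed

lemma laur_eq_iff: "laur p = laur q \<longleftrightarrow> p = q"
proof
  assume "laur p = laur q"
  then have "Poly_Mapping.lookup (laur p) (int n) = Poly_Mapping.lookup (laur q) (int n)" for n by simp
  then show "p = q" by (simp add: lookup_laur poly_eq_iff)
qed simp

lemma laur_0 [simp]: "laur 0 = 0"
  by (simp add: laur_def)

lemma laur_eq_0_iff [simp]: "laur p = 0 \<longleftrightarrow> p = 0"
  using laur_eq_iff[of p 0] by simp

lemma laur_add: "laur (p + q) = laur p + laur q"
  by (rule poly_mapping_eqI) (simp add: lookup_laur lookup_add)

lemma laur_diff: "laur (p - q) = laur p - laur q"
  by (rule poly_mapping_eqI) (simp add: lookup_laur lookup_minus)

lemma laur_smult: "laur (Polynomial.smult c p) = Poly_Mapping.single 0 c * laur p"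
  by (rule poly_mapping_eqI) (simp add: lookup_laur lookup_single_mult)

lemma laur_pCons_0: "laur (pCons 0 p) = xpow 1 * laur p"
  by (simp add: laur_pCons)

lemma laur_mult: "laur (p * q) = laur p * laur q"
proof (induction p)
  case 0
  then show ?case by simp
next
  case (pCons c p)
  then show ?case
    by (simp add: laur_pCons laur_add laur_smult laur_pCons_0 algebra_simps)
qed

section \<open>Clearing denominators in Laurent polynomials\<close>

lemma xpow_cancel: "xpow (- i) * (xpow i * r) = (r :: int \<Rightarrow>\<^sub>0 'k::field)"
  by (simp add: mult.assoc[symmetric] mult_single)

lemma range_laur:
  fixes r :: "int \<Rightarrow>\<^sub>0 'k::field"
  assumes "\<And>i. i < 0 \<Longrightarrow> Poly_Mapping.lookup r i = 0"
  shows "r \<in> range laur"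
proof -
  \<comment> \<open>\<open>Abs_poly\<close> is meaningful only for functions that vanish almost
    everywhere, so the finite support is pulled back along \<open>int\<close>.\<close>
  have "finite (int -` {i. Poly_Mapping.lookup r i \<noteq> 0})"
    by (rule finite_vimageI[OF finite_lookup]) simp
  then have "finite {n. Poly_Mapping.lookup r (int n) \<noteq> 0}" by (simp add: vimage_def)
  then have *: "poly.coeff (Abs_poly (\<lambda>n. Poly_Mapping.lookup r (int n))) n = Poly_Mapping.lookup r (int n)" for n
    by (subst Abs_poly_inverse) (auto simp: eventually_cofinite)
  have "r = laur (Abs_poly (\<lambda>n. Poly_Mapping.lookup r (int n)))"
    by (rule poly_mapping_eqI) (simp add: lookup_laur * assms)
  then show ?thesis by blast
qed

lemma xpow_mult_in_range_laur:
  fixes r :: "int \<Rightarrow>\<^sub>0 'k::field"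
  obtains n q where "xpow (int n) * r = laur q"
proof -
  \<comment> \<open>The pole order of \<open>r\<close> at 0; the inserted 0 covers
    \<open>r = 0\<close>, where there are no exponents to maximise over.\<close>
  define n where "n = Max (insert 0 ((\<lambda>i. nat (- i)) ` Poly_Mapping.keys r))"
  have "nat (- i) \<le> n" if "Poly_Mapping.lookup r i \<noteq> 0" for i
    unfolding n_def by (rule Max_ge) (use that in \<open>auto simp: in_keys_iff\<close>)
  then have "xpow (int n) * r \<in> range laur"
    by (intro range_laur) (force simp: lookup_single_mult)
  then show ?thesis using that by blast
qed

text \<open>As \<open>x\<close> does not divide \<open>g\<close>, a denominator of \<open>r\<close>
  cannot be absorbed by \<open>g\<close>: if \<open>x\<close> divides \<open>w * g\<close>, the
  constant coefficients show that \<open>x\<close> divides \<open>w\<close>, and one power of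
  \<open>x\<close> can be cancelled.\<close>

lemma laur_quotient:
  fixes r :: "int \<Rightarrow>\<^sub>0 'k::field"
  assumes "r * laur g = laur q" "poly.coeff g 0 \<noteq> 0"
  obtains u where "r = laur u"
proof -
  obtain n w where "xpow (int n) * r = laur w" by (rule xpow_mult_in_range_laur)
  then have "\<exists>u. r = laur u"
  proof (induction n arbitrary: w)
    case 0
    then show ?case by auto
  next
    case (Suc n)
    have "laur (w * g) = xpow (int (Suc n)) * (r * laur g)"
      using Suc(2) by (simp add: laur_mult mult.assoc)
    also have "\<dots> = xpow (int (Suc n)) * laur q" using assms by simp
    finally have "Poly_Mapping.lookup (laur (w * g)) 0 = 0" by (simp add: lookup_single_mult lookup_laur)
    then have "poly.coeff w 0 = 0" using assms by (simp add: lookup_laur coeff_mult)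
    then obtain w' where "w = pCons 0 w'" by (metis pCons_cases coeff_pCons_0)
    then have "xpow 1 * (xpow (int n) * r) = xpow 1 * laur w'"
      using Suc(2) by (simp add: laur_pCons_0 mult.assoc[symmetric] mult_single)
    then have "xpow (int n) * r = laur w'" by (metis xpow_cancel)
    then show ?case by (rule Suc(1))
  qed
  then show ?thesis using that by blast
qed

text \<open>These are the remainders modulo a polynomial of degree \<open>d\<close>. The bound is
  put on coefficients because \<open>degree q < d\<close> would lose the zero polynomial at
  \<open>d = 0\<close>.\<close>

lemma card_polys_below:
  "finite {q :: 'k::{field, finite} poly. \<forall>i\<ge>d. poly.coeff q i = 0} \<and>
   card {q :: 'k poly. \<forall>i\<ge>d. poly.coeff q i = 0} = CARD('k) ^ d"
proof (induction d)
  case 0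
  have "{q :: 'k poly. \<forall>i\<ge>0. poly.coeff q i = 0} = {0}" by (auto simp: poly_eq_iff)
  then show ?case by simp
next
  case (Suc d)
  have *: "bij_betw (\<lambda>(c, q). pCons c q) (UNIV \<times> {q :: 'k poly. \<forall>i\<ge>d. poly.coeff q i = 0})
      {q :: 'k poly. \<forall>i\<ge>Suc d. poly.coeff q i = 0}"
  proof (rule bij_betw_imageI)
    show "inj_on (\<lambda>(c, q). pCons c q) (UNIV \<times> {q :: 'k poly. \<forall>i\<ge>d. poly.coeff q i = 0})"
      by (auto simp: inj_on_def)
    show "(\<lambda>(c, q). pCons c q) ` (UNIV \<times> {q :: 'k poly. \<forall>i\<ge>d. poly.coeff q i = 0}) =
        {q :: 'k poly. \<forall>i\<ge>Suc d. poly.coeff q i = 0}"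
    proof (intro equalityI subsetI)
      fix q :: "'k poly" assume "q \<in> {q. \<forall>i\<ge>Suc d. poly.coeff q i = 0}"
      moreover obtain c s where "q = pCons c s" by (rule pCons_cases)
      ultimately have "(c, s) \<in> UNIV \<times> {q. \<forall>i\<ge>d. poly.coeff q i = 0}" "q = (\<lambda>(c, q). pCons c q) (c, s)"
        by (force simp: coeff_pCons dest: spec[of _ "Suc _"])+
      then show "q \<in> (\<lambda>(c, q). pCons c q) ` (UNIV \<times> {q :: 'k poly. \<forall>i\<ge>d. poly.coeff q i = 0})" by blast
    qed (auto simp: coeff_pCons split: nat.splits)
  qed
  show ?case
    using bij_betw_same_card[OF *] bij_betw_finite[OF *] Suc by (simp add: card_cartesian_product)
qed

lemma card_monic_polys:
  "card {g :: 'k::{field, finite} poly. monic g \<and> degree g = d} = CARD('k) ^ d"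
proof -
  have "bij_betw (\<lambda>q. Polynomial.monom 1 d + q) {q :: 'k poly. \<forall>i\<ge>d. poly.coeff q i = 0} {g. monic g \<and> degree g = d}"
  proof (rule bij_betw_imageI)
    show "(\<lambda>q. Polynomial.monom 1 d + q) ` {q :: 'k poly. \<forall>i\<ge>d. poly.coeff q i = 0} = {g. monic g \<and> degree g = d}"
    proof (intro equalityI subsetI)
      fix g assume "g \<in> (\<lambda>q. Polynomial.monom 1 d + q) ` {q :: 'k poly. \<forall>i\<ge>d. poly.coeff q i = 0}"
      then obtain q :: "'k poly" where q: "g = Polynomial.monom 1 d + q" "\<forall>i\<ge>d. poly.coeff q i = 0" by auto
      have "degree g = d"
      proof (rule antisym)
        show "degree g \<le> d" using q by (intro degree_le) auto
        show "d \<le> degree g" using q by (intro le_degree) auto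
      qed
      then show "g \<in> {g. monic g \<and> degree g = d}" using q by simp
    next
      fix g :: "'k poly" assume g: "g \<in> {g. monic g \<and> degree g = d}"
      then have "\<forall>i\<ge>d. poly.coeff (g - Polynomial.monom 1 d) i = 0"
        by (auto simp: coeff_eq_0 le_less)
      then show "g \<in> (\<lambda>q. Polynomial.monom 1 d + q) ` {q :: 'k poly. \<forall>i\<ge>d. poly.coeff q i = 0}"
        by (intro image_eqI[of _ _ "g - Polynomial.monom 1 d"]) auto
    qed
  qed (auto simp: inj_on_def)
  from bij_betw_same_card[OF this] show ?thesis
    using card_polys_below[where ?'k='k, of d] by simp
qed

text \<open>These polynomials will be the generators of the ideals of index
  \<open>CARD('k) ^ Suc d\<close>. In positive degree the constant and the leading coefficient are
  different coefficients, so the two conditions are independent.\<close>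

lemma card_monic_polys_nonzero_const:
  "card {g :: 'k::{field, finite} poly. monic g \<and> degree g = Suc d \<and> poly.coeff g 0 \<noteq> 0} =
   (CARD('k) - 1) * CARD('k) ^ d"
proof -
  have "bij_betw (\<lambda>(c, q). pCons c q) ((UNIV - {0}) \<times> {q :: 'k poly. monic q \<and> degree q = d})
      {g :: 'k poly. monic g \<and> degree g = Suc d \<and> poly.coeff g 0 \<noteq> 0}"
  proof (rule bij_betw_imageI)
    show "inj_on (\<lambda>(c, q). pCons c q) ((UNIV - {0}) \<times> {q :: 'k poly. monic q \<and> degree q = d})"
      by (auto simp: inj_on_def)
    show "(\<lambda>(c, q). pCons c q) ` ((UNIV - {0}) \<times> {q :: 'k poly. monic q \<and> degree q = d}) =
        {g :: 'k poly. monic g \<and> degree g = Suc d \<and> poly.coeff g 0 \<noteq> 0}"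
    proof (intro equalityI subsetI)
      fix q :: "'k poly" assume q: "q \<in> {g. monic g \<and> degree g = Suc d \<and> poly.coeff g 0 \<noteq> 0}"
      obtain c s where cs: "q = pCons c s" by (rule pCons_cases)
      then have "s \<noteq> 0" using q by auto
      then have "(c, s) \<in> (UNIV - {0}) \<times> {q. monic q \<and> degree q = d}" using q cs by auto
      then show "q \<in> (\<lambda>(c, q). pCons c q) ` ((UNIV - {0}) \<times> {q :: 'k poly. monic q \<and> degree q = d})"
        using cs by (force simp: image_iff)
    qed (auto split: if_splits)
  qed
  from bij_betw_same_card[OF this] show ?thesis
    using card_monic_polys[where ?'k='k, of d]
    by (simp add: card_cartesian_product card_Diff_subset)
qed

section \<open>Submodules of free modules\<close>

text \<open>Turns addition of the type class into a group record, so that \<open>subgroup\<close>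
  and \<open>rcosets\<close> apply to sets of functions and to ideals alike.\<close>

definition add_group :: "'a::ab_group_add set \<Rightarrow> 'a monoid"
  where "add_group A = \<lparr>carrier = A, monoid.mult = (+), one = 0\<rparr>"

definition add_closed :: "'a::ab_group_add set \<Rightarrow> bool"
  where "add_closed A \<longleftrightarrow> 0 \<in> A \<and> (\<forall>a\<in>A. \<forall>b\<in>A. a - b \<in> A)"

lemma add_group_simps [simp]:
  "carrier (add_group A) = A" "x \<otimes>\<^bsub>add_group A\<^esub> y = x + y" "\<one>\<^bsub>add_group A\<^esub> = 0"
  by (auto simp: add_group_def)

lemma add_closedD:
  assumes "add_closed A"
  shows "0 \<in> A" "a \<in> A \<Longrightarrow> b \<in> A \<Longrightarrow> a - b \<in> A" "a \<in> A \<Longrightarrow> - a \<in> A" "a \<in> A \<Longrightarrow> b \<in> A \<Longrightarrow> a + b \<in> A"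
proof -
  show *: "0 \<in> A" "a \<in> A \<Longrightarrow> b \<in> A \<Longrightarrow> a - b \<in> A" for a b using assms by (auto simp: add_closed_def)
  show m: "a \<in> A \<Longrightarrow> - a \<in> A" for a using *(2)[OF *(1), of a] by simp
  show "a \<in> A \<Longrightarrow> b \<in> A \<Longrightarrow> a + b \<in> A" using *(2)[of a "- b"] m[of b] by simp
qed

lemma group_add_group: "add_closed A \<Longrightarrow> group (add_group A)"
  by (rule groupI) (auto simp: add_closedD add.assoc intro: exI bexI[of _ "- _"])

lemma inv_add_group: "add_closed A \<Longrightarrow> a \<in> A \<Longrightarrow> inv\<^bsub>add_group A\<^esub> a = - a"
  by (rule group.inv_equality[OF group_add_group]) (auto simp: add_closedD)

lemma subgroup_add_group:
  "add_closed A \<Longrightarrow> subgroup M (add_group A) \<longleftrightarrow> M \<subseteq> A \<and> add_closed M"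
proof
  assume A: "add_closed A" and M: "subgroup M (add_group A)"
  have "M \<subseteq> A" using subgroup.subset[OF M] by simp
  moreover have "a - b \<in> M" if "a \<in> M" "b \<in> M" for a b
    using subgroup.m_closed[OF M that(1) subgroup.m_inv_closed[OF M that(2)]] \<open>M \<subseteq> A\<close> that
    by (auto simp: inv_add_group[OF A])
  ultimately show "M \<subseteq> A \<and> add_closed M"
    using subgroup.one_closed[OF M] by (simp add: add_closed_def)
next
  assume "add_closed A" "M \<subseteq> A \<and> add_closed M"
  then show "subgroup M (add_group A)"
    by (intro subgroup.intro) (auto simp: add_closedD inv_add_group subset_iff)
qed

lemma coset_add_group: "M #>\<^bsub>add_group A\<^esub> v = {w. w - v \<in> M}"
  by (force simp: r_coset_def)

lemma rcosets_add_group: "rcosets\<^bsub>add_group A\<^esub> M = (\<lambda>v. {w. w - v \<in> M}) ` A"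
  by (auto simp: RCOSETS_def coset_add_group)

lemma add_cosets_eq_iff:
  assumes "add_closed M"
  shows "{w. w - v \<in> M} = {w. w - v' \<in> M} \<longleftrightarrow> v - v' \<in> M"
proof
  assume "{w. w - v \<in> M} = {w. w - v' \<in> M}"
  moreover have "v \<in> {w. w - v \<in> M}" using add_closedD(1)[OF assms] by simp
  ultimately show "v - v' \<in> M" by blast
next
  assume v: "v - v' \<in> M"
  have "w - v \<in> M \<longleftrightarrow> w - v' \<in> M" for w
    using add_closedD(4)[OF assms _ v, of "w - v"] add_closedD(2)[OF assms _ v, of "w - v'"] by auto
  then show "{w. w - v \<in> M} = {w. w - v' \<in> M}" by auto
qed

text \<open>An infinite index reads as 0, so the later assumption that the index is positive is the
  finite index condition.\<close>

abbreviation add_index :: "'a::ab_group_add set \<Rightarrow> 'a set \<Rightarrow> nat"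
  where "add_index A M \<equiv> card (rcosets\<^bsub>add_group A\<^esub> M)"

text \<open>Padding by zeros makes \<open>R ^ k\<close> a literal subset of
  \<open>R ^ (k + 1)\<close>, so the induction on the rank can intersect without an
  embedding.\<close>

definition coord_space :: "nat \<Rightarrow> (nat \<Rightarrow> 'r::comm_ring_1) set"
  where "coord_space k = {f. \<forall>i\<ge>k. f i = 0}"

definition scale :: "'r::comm_ring_1 \<Rightarrow> (nat \<Rightarrow> 'r) \<Rightarrow> nat \<Rightarrow> 'r"
  where "scale r f = (\<lambda>i. r * f i)"

definition coord_submodules :: "nat \<Rightarrow> (nat \<Rightarrow> 'r::comm_ring_1) set set"
  where "coord_submodules k =
    {M. M \<subseteq> coord_space k \<and> add_closed M \<and> (\<forall>r. \<forall>f\<in>M. scale r f \<in> M)}"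

definition ideals :: "'r::comm_ring_1 set set"
  where "ideals = {J. add_closed J \<and> (\<forall>r. \<forall>a\<in>J. r * a \<in> J)}"

lemma add_closed_coord_space: "add_closed (coord_space k)"
  by (auto simp: add_closed_def coord_space_def)

lemma add_closed_UNIV: "add_closed UNIV"
  by (auto simp: add_closed_def)

lemma scale_diff: "scale r (f - g) = scale r f - scale r g"
  and scale_add_left: "scale (r + s) f = scale r f + scale s f"
  and scale_diff_left: "scale (r - s) f = scale r f - scale s f"
  and scale_scale: "scale r (scale s f) = scale (r * s) f"
  and scale_one: "scale 1 f = f"
  and scale_zero_left: "scale 0 f = 0"
  and scale_apply: "scale r f i = r * f i"
  by (auto simp: scale_def fun_eq_iff algebra_simps)

text \<open>The last coordinate is a homomorphism from \<open>R ^ (k + 1)\<close> onto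
  \<open>R\<close> with kernel \<open>R ^ k\<close>, so \<open>card_rcosets_hom\<close>
  applies.\<close>

lemma coord_submodule_index:
  assumes M: "M \<in> coord_submodules (Suc k)"
  shows "M \<inter> coord_space k \<in> coord_submodules k" "(\<lambda>f. f k) ` M \<in> ideals"
    "add_index (coord_space (Suc k)) M =
      add_index (coord_space k) (M \<inter> coord_space k) * add_index UNIV ((\<lambda>f. f k) ` M)"
proof -
  have Mc: "add_closed M" and Ms: "M \<subseteq> coord_space (Suc k)" and Mr: "\<And>r f. f \<in> M \<Longrightarrow> scale r f \<in> M"
    using M by (auto simp: coord_submodules_def)
  have "add_closed (M \<inter> coord_space k)"
    using Mc add_closed_coord_space[of k] by (auto simp: add_closed_def)
  then show "M \<inter> coord_space k \<in> coord_submodules k"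
    using Mr by (auto simp: coord_submodules_def coord_space_def scale_apply)
  show "(\<lambda>f. f k) ` M \<in> ideals"
    unfolding ideals_def add_closed_def
  proof (intro CollectI conjI ballI allI)
    show "0 \<in> (\<lambda>f. f k) ` M"
      using add_closedD(1)[OF Mc] by (intro image_eqI[of _ _ 0]) (auto simp: zero_fun_def)
    show "a - b \<in> (\<lambda>f. f k) ` M" if "a \<in> (\<lambda>f. f k) ` M" "b \<in> (\<lambda>f. f k) ` M" for a b
    proof -
      from that obtain f g where "f \<in> M" "g \<in> M" "a = f k" "b = g k" by auto
      then show ?thesis using add_closedD(2)[OF Mc] by (intro image_eqI[of _ _ "f - g"]) auto
    qed
    show "r * a \<in> (\<lambda>f. f k) ` M" if "a \<in> (\<lambda>f. f k) ` M" for r a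
      using that Mr by (auto intro!: image_eqI[of _ _ "scale r _"] simp: scale_apply)
  qed
  let ?G = "add_group (coord_space (Suc k)) :: (nat \<Rightarrow> 'a) monoid"
  let ?Q = "add_group UNIV :: 'a monoid"
  have hom: "group_hom ?G ?Q (\<lambda>f. f k)"
    by (simp add: group_hom_def group_hom_axioms_def group_add_group add_closed_coord_space
        add_closed_UNIV hom_def)
  have surj: "(\<lambda>f. f k) ` carrier ?G = carrier ?Q"
  proof -
    have "x \<in> (\<lambda>f. f k) ` coord_space (Suc k)" for x :: 'a
      by (rule image_eqI[of _ _ "\<lambda>i. if i = k then x else 0"]) (auto simp: coord_space_def)
    then show ?thesis by auto
  qed
  have ker: "kernel ?G ?Q (\<lambda>f. f k) = coord_space k"
    by (auto simp: kernel_def coord_space_def) (metis Suc_leI le_neq_implies_less)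
  have "?G\<lparr>carrier := coord_space k\<rparr> = add_group (coord_space k)"
    by (simp add: add_group_def)
  then show "add_index (coord_space (Suc k)) M =
      add_index (coord_space k) (M \<inter> coord_space k) * add_index UNIV ((\<lambda>f. f k) ` M)"
    using card_rcosets_hom[OF hom surj, of M] Ms Mc
    by (simp add: ker subgroup_add_group add_closed_coord_space)
qed

text \<open>A submodule \<open>M\<close> with given intersection \<open>N\<close> and given image \<open>R a\<close> is determined by the coset
  of \<open>N\<close> formed by the \<open>v\<close> with \<open>(v, a) \<in> M\<close>, and every coset occurs because \<open>R a\<close> is free on \<open>a\<close>.\<close>

lemma bij_betw_coord_submodules_fibre:
  fixes a :: "'r::idom"
  assumes N: "N \<in> coord_submodules k" and a: "a \<noteq> 0"
  defines "F \<equiv> {M \<in> coord_submodules (Suc k). M \<inter> coord_space k = N \<and> (\<lambda>f. f k) ` M = range (\<lambda>r. r * a)}"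
  shows "bij_betw (\<lambda>M. {v \<in> coord_space k. v(k := a) \<in> M}) F (rcosets\<^bsub>add_group (coord_space k)\<^esub> N)"
proof (rule bij_betw_imageI)
  let ?\<Psi> = "\<lambda>M. {v \<in> coord_space k. v(k := a) \<in> M}"
  have Nc: "add_closed N" and Ns: "N \<subseteq> coord_space k" and Nr: "\<And>r f. f \<in> N \<Longrightarrow> scale r f \<in> N"
    using N by (auto simp: coord_submodules_def)
  have diff_upd: "v(k := a) - w(k := a) = v - w" if "v \<in> coord_space k" "w \<in> coord_space k" for v w
    using that by (auto simp: fun_eq_iff coord_space_def)
  have down: "f(k := 0) \<in> coord_space k" if "f \<in> coord_space (Suc k)" for f :: "nat \<Rightarrow> 'r"
    using that by (auto simp: coord_space_def)
  have zero: "f \<in> coord_space k" if "f \<in> coord_space (Suc k)" "f k = 0" for f :: "nat \<Rightarrow> 'r"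
    using down[OF that(1)] that(2) by (metis fun_upd_triv)
  have FD: "add_closed M" "M \<subseteq> coord_space (Suc k)" "\<And>r f. f \<in> M \<Longrightarrow> scale r f \<in> M"
    "M \<inter> coord_space k = N" "(\<lambda>f. f k) ` M = range (\<lambda>r. r * a)" if "M \<in> F" for M
    using that by (auto simp: F_def coord_submodules_def)
  \<comment> \<open>The generator \<open>a\<close> itself lies in the image of \<open>M\<close>, so
    some element of \<open>M\<close> has last coordinate \<open>a\<close>.\<close>
  have lift: "\<exists>v. v \<in> ?\<Psi> M" if M: "M \<in> F" for M
  proof -
    have "1 * a \<in> (\<lambda>f. f k) ` M" unfolding FD(5)[OF M] by blast
    then obtain f where f: "f \<in> M" "f k = a" by auto
    then have "(f(k := 0))(k := a) = f" by auto
    then show ?thesis using f down[of f] FD(2)[OF M] by (intro exI[of _ "f(k := 0)"]) auto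
  qed
  show "inj_on ?\<Psi> F"
  proof -
    have "M \<subseteq> M'" if M: "M \<in> F" and M': "M' \<in> F" and eq: "?\<Psi> M = ?\<Psi> M'" for M M'
    proof
      fix f assume f: "f \<in> M"
      from lift[OF M] obtain v where v: "v \<in> ?\<Psi> M" by blast
      have "f k \<in> range (\<lambda>r. r * a)" using f FD(5)[OF M] by blast
      then obtain r where r: "f k = r * a" by blast
      \<comment> \<open>Subtracting the right multiple of the lift kills the last coordinate and
        moves \<open>f\<close> into \<open>N\<close>, where \<open>M\<close> and \<open>M'\<close>
        agree.\<close>
      have d: "f - scale r (v(k := a)) \<in> M"
        using add_closedD(2)[OF FD(1)[OF M] f FD(3)[OF M]] v by simp
      then have "f - scale r (v(k := a)) \<in> coord_space k"
        using FD(2)[OF M] by (intro zero) (auto simp: r scale_apply)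
      then have "f - scale r (v(k := a)) \<in> M'" using d FD(4)[OF M] FD(4)[OF M'] by blast
      moreover have "scale r (v(k := a)) \<in> M'" using v eq FD(3)[OF M'] by blast
      ultimately show "f \<in> M'" using add_closedD(4)[OF FD(1)[OF M']] by fastforce
    qed
    then show ?thesis unfolding inj_on_def by blast
  qed
  show "?\<Psi> ` F = rcosets\<^bsub>add_group (coord_space k)\<^esub> N"
  proof (intro equalityI subsetI)
    fix C assume "C \<in> ?\<Psi> ` F"
    then obtain M where M: "M \<in> F" and C: "C = ?\<Psi> M" by blast
    from lift[OF M] obtain v where v: "v \<in> ?\<Psi> M" by blast
    have "w \<in> C \<longleftrightarrow> w - v \<in> N" for w
    proof
      assume "w \<in> C"
      then have w: "w \<in> coord_space k" "w(k := a) \<in> M" by (auto simp: C)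
      then have "w(k := a) - v(k := a) \<in> M" using add_closedD(2)[OF FD(1)[OF M]] v by blast
      then show "w - v \<in> N"
        using diff_upd[of w v] w v FD(4)[OF M] add_closedD(2)[OF add_closed_coord_space] by auto
    next
      assume wv: "w - v \<in> N"
      have w: "w \<in> coord_space k"
        using add_closedD(4)[OF add_closed_coord_space, of "w - v" k v] wv Ns v by auto
      have "w(k := a) = (w - v) + v(k := a)"
        using diff_upd[of w v] w v by (simp add: algebra_simps)
      moreover have "w - v \<in> M" using wv FD(4)[OF M] by blast
      ultimately have "w(k := a) \<in> M" using v add_closedD(4)[OF FD(1)[OF M]] by simp
      then show "w \<in> C" using w by (simp add: C)
    qed
    then have "C = {w. w - v \<in> N}" by auto
    then show "C \<in> rcosets\<^bsub>add_group (coord_space k)\<^esub> N" using v by (auto simp: rcosets_add_group)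
  next
    fix C assume "C \<in> rcosets\<^bsub>add_group (coord_space k)\<^esub> N"
    then obtain v where v: "v \<in> coord_space k" and C: "C = {w. w - v \<in> N}"
      by (auto simp: rcosets_add_group)
    define u where "u = v(k := a)"
    have u: "u \<in> coord_space (Suc k)" using v by (auto simp: u_def coord_space_def)
    \<comment> \<open>This is \<open>N + R u\<close>. The multiplier \<open>r\<close> is tied to the
      last coordinate, where it is unique because \<open>a\<close> is nonzero in a domain.\<close>
    define M where "M = {f \<in> coord_space (Suc k). \<exists>r. f k = r * a \<and> f - scale r u \<in> N}"
    have MI: "f \<in> M" if "f \<in> coord_space (Suc k)" "f k = r * a" "f - scale r u \<in> N" for f r
      using that by (auto simp: M_def)
    have sc: "scale r f \<in> coord_space l" if "f \<in> coord_space l" for r l and f :: "nat \<Rightarrow> 'r"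
      using that by (auto simp: coord_space_def scale_apply)
    have "add_closed M"
      unfolding add_closed_def
    proof (intro conjI ballI)
      show "0 \<in> M"
        by (rule MI[of _ 0])
          (auto simp: scale_zero_left add_closedD(1)[OF Nc] add_closedD(1)[OF add_closed_coord_space])
      fix f g assume "f \<in> M" "g \<in> M"
      then obtain r s where rs: "f k = r * a" "g k = s * a" "f - scale r u \<in> N" "g - scale s u \<in> N"
        and fg: "f \<in> coord_space (Suc k)" "g \<in> coord_space (Suc k)" by (auto simp: M_def)
      have eq: "(f - scale r u) - (g - scale s u) = (f - g) - scale (r - s) u"
        by (simp add: scale_diff_left algebra_simps)
      have "(f - g) - scale (r - s) u \<in> N"
        using add_closedD(2)[OF Nc rs(3,4)] unfolding eq .
      then show "f - g \<in> M"
        using rs(1,2) fg add_closedD(2)[OF add_closed_coord_space]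
        by (intro MI[of _ "r - s"]) (auto simp: left_diff_distrib)
    qed
    moreover have "scale t f \<in> M" if "f \<in> M" for t f
    proof -
      from that obtain r where r: "f k = r * a" "f - scale r u \<in> N" "f \<in> coord_space (Suc k)"
        by (auto simp: M_def)
      have "scale t (f - scale r u) = scale t f - scale (t * r) u"
        by (simp add: scale_diff scale_scale)
      then show ?thesis
        using Nr[OF r(2), of t] r sc by (intro MI[of _ "t * r"]) (auto simp: scale_apply)
    qed
    ultimately have Msub: "M \<in> coord_submodules (Suc k)"
      by (auto simp: coord_submodules_def M_def)
    have "M \<inter> coord_space k = N"
    proof (intro equalityI subsetI)
      fix f assume f: "f \<in> M \<inter> coord_space k"
      then obtain r where r: "f k = r * a" "f - scale r u \<in> N" by (auto simp: M_def)
      then have "r = 0" using a f by (auto simp: coord_space_def)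
      then show "f \<in> N" using r by (simp add: scale_zero_left)
    next
      fix f assume "f \<in> N"
      moreover then have "f \<in> coord_space k" using Ns by blast
      ultimately show "f \<in> M \<inter> coord_space k"
        by (auto intro!: MI[of _ 0] simp: scale_zero_left) (auto simp: coord_space_def)
    qed
    moreover have "(\<lambda>f. f k) ` M = range (\<lambda>r. r * a)"
    proof (intro equalityI subsetI)
      fix x assume "x \<in> range (\<lambda>r. r * a)"
      then obtain r where "x = r * a" by blast
      moreover have "scale r u \<in> M"
        by (rule MI[of _ r]) (auto simp: sc u add_closedD(1)[OF Nc] scale_apply, simp add: u_def)
      ultimately show "x \<in> (\<lambda>f. f k) ` M"
        by (intro image_eqI[of _ _ "scale r u"]) (auto simp: scale_apply u_def)
    qed (auto simp: M_def)
    ultimately have "M \<in> F" using Msub by (simp add: F_def)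
    moreover have "?\<Psi> M = C"
    proof (intro equalityI subsetI)
      fix w assume "w \<in> ?\<Psi> M"
      then obtain r where w: "w \<in> coord_space k" "a = r * a" "w(k := a) - scale r u \<in> N"
        by (auto simp: M_def)
      then have "r = 1" using a by simp
      then show "w \<in> C" using w v diff_upd[of w v] by (simp add: C scale_one u_def)
    next
      fix w assume "w \<in> C"
      then have wv: "w - v \<in> N" by (simp add: C)
      have w: "w \<in> coord_space k"
        using add_closedD(4)[OF add_closed_coord_space, of "w - v" k v] wv Ns v by auto
      have "w(k := a) \<in> M"
        by (rule MI[of _ 1]) (use w wv v diff_upd[of w v] in \<open>auto simp: scale_one u_def, auto simp: coord_space_def\<close>)
      then show "w \<in> ?\<Psi> M" using w by simp
    qed
    ultimately show "C \<in> ?\<Psi> ` F" by blast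
  qed
qed

section \<open>Ideals of the Laurent polynomial ring\<close>

definition laur_ideal :: "'k::field poly \<Rightarrow> (int \<Rightarrow>\<^sub>0 'k) set"
  where "laur_ideal g = range (\<lambda>r. r * laur g)"

lemma laur_ideal_in_ideals: "laur_ideal g \<in> ideals"
  unfolding laur_ideal_def ideals_def add_closed_def
  by (auto simp: image_iff left_diff_distrib[symmetric] mult.assoc[symmetric] intro: exI[of _ 0])

text \<open>By \<open>laur_quotient\<close>, dividing a polynomial by \<open>g\<close> in the
  Laurent ring introduces no negative powers.\<close>

lemma laur_in_laur_ideal_iff:
  assumes "poly.coeff g 0 \<noteq> 0"
  shows "laur q \<in> laur_ideal g \<longleftrightarrow> g dvd q"
proof
  assume "laur q \<in> laur_ideal g"
  then obtain r where r: "r * laur g = laur q" by (metis laur_ideal_def rangeE)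
  then obtain u where "r = laur u" using laur_quotient[OF _ assms] by blast
  then show "g dvd q" using r by (metis dvd_triv_right laur_eq_iff laur_mult)
next
  assume "g dvd q"
  then show "laur q \<in> laur_ideal g" by (auto simp: laur_ideal_def laur_mult mult.commute elim!: dvdE)
qed

text \<open>Division with remainder by a nonzero polynomial of least degree in \<open>J\<close>. Its
  constant coefficient cannot vanish: dividing by the unit \<open>x\<close> would stay in
  \<open>J\<close> and lower the degree.\<close>

lemma ideal_eq_laur_ideal:
  assumes J: "J \<in> ideals" and "J \<noteq> {0}"
  obtains g where "monic g" "poly.coeff g 0 \<noteq> 0" "J = laur_ideal g"
proof -
  have Jc: "add_closed J" and Jr: "\<And>r a. a \<in> J \<Longrightarrow> r * a \<in> J"
    using J by (auto simp: ideals_def)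
  define P where "P = (\<lambda>q. q \<noteq> 0 \<and> laur q \<in> J)"
  obtain r where r: "r \<in> J" "r \<noteq> 0" using assms(2) add_closedD(1)[OF Jc] by blast
  obtain n q where nq: "xpow (int n) * r = laur q" by (rule xpow_mult_in_range_laur)
  have "xpow (int n) * r \<noteq> 0" using r(2) xpow_cancel[of "int n" r] by auto
  then have "P q" using Jr[OF r(1), of "xpow (int n)"] nq by (auto simp: P_def)
  then obtain h where h: "P h" and h_min: "\<And>q. P q \<Longrightarrow> degree h \<le> degree q"
    using ex_has_least_nat[of P q degree] by blast
  have hdvd: "h dvd q" if "laur q \<in> J" for q
  proof (rule ccontr)
    assume "\<not> h dvd q"
    then have nz: "q mod h \<noteq> 0" by auto
    have "laur (q mod h) = laur q - laur (q div h) * laur h"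
      by (simp add: laur_mult[symmetric] laur_diff[symmetric] minus_div_mult_eq_mod)
    then have "laur (q mod h) \<in> J" using that h Jr add_closedD(2)[OF Jc] by (auto simp: P_def)
    then have "degree h \<le> degree (q mod h)" using nz h_min by (auto simp: P_def)
    then show False using degree_mod_less'[OF _ nz] h by (auto simp: P_def)
  qed
  define g where "g = Polynomial.smult (inverse (lead_coeff h)) h"
  have monic: "monic g" using h by (auto simp: g_def P_def)
  have gJ: "laur g \<in> J" using h Jr by (auto simp: g_def laur_smult P_def)
  have gdvd: "g dvd q" if "laur q \<in> J" for q
    using hdvd[OF that] h by (auto simp: g_def smult_dvd_iff P_def)
  have g0: "poly.coeff g 0 \<noteq> 0"
  proof
    assume "poly.coeff g 0 = 0"
    then obtain g' where g': "g = pCons 0 g'" by (metis pCons_cases coeff_pCons_0)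
    then have nz: "g' \<noteq> 0" using monic by auto
    have "laur g' = xpow (- 1) * laur g" by (simp only: g' laur_pCons_0 xpow_cancel)
    then have "laur g' \<in> J" using Jr[OF gJ] by simp
    then have "g dvd g'" by (rule gdvd)
    then show False using dvd_imp_degree_le[of g g'] nz g' by auto
  qed
  have "J = laur_ideal g"
  proof (intro equalityI subsetI)
    fix r assume r: "r \<in> J"
    obtain n q where nq: "xpow (int n) * r = laur q" by (rule xpow_mult_in_range_laur)
    have "g dvd q" using Jr[OF r, of "xpow (int n)"] nq by (intro gdvd) simp
    then obtain u where "q = u * g" by (metis dvdE mult.commute)
    then have "r = (xpow (- int n) * laur u) * laur g"
      using nq xpow_cancel[of "int n" r] by (simp add: laur_mult mult.assoc)
    then show "r \<in> laur_ideal g" by (auto simp: laur_ideal_def)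
  next
    fix r assume "r \<in> laur_ideal g"
    then show "r \<in> J" using Jr[OF gJ] by (auto simp: laur_ideal_def)
  qed
  then show ?thesis using that monic g0 by blast
qed

text \<open>The units of the Laurent ring are the monomials \<open>c x^i\<close>; being monic fixes
  \<open>c\<close> and a nonzero constant coefficient fixes \<open>i\<close>.\<close>

lemma laur_ideal_inj:
  assumes "monic g" "poly.coeff g 0 \<noteq> 0" "monic h" "poly.coeff h 0 \<noteq> 0" "laur_ideal g = laur_ideal h"
  shows "g = h"
proof (rule poly_dvd_antisym)
  have "laur g \<in> laur_ideal g" "laur h \<in> laur_ideal h"
    by (simp_all add: laur_in_laur_ideal_iff assms(2,4))
  then have *: "laur h \<in> laur_ideal g" "laur g \<in> laur_ideal h" using assms(5) by simp_all
  show "g dvd h" using *(1) laur_in_laur_ideal_iff[OF assms(2)] by blast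
  show "h dvd g" using *(2) laur_in_laur_ideal_iff[OF assms(4)] by blast
qed (use assms in simp)

text \<open>The cosets are the single elements, and the powers of \<open>x\<close> already give
  infinitely many. Hence a positive index excludes the zero ideal.\<close>

lemma add_index_zero_ideal: "add_index UNIV {0 :: int \<Rightarrow>\<^sub>0 'k::field} = 0"
proof -
  have "inj (\<lambda>v :: int \<Rightarrow>\<^sub>0 'k. {w. w - v \<in> {0}})" by (auto simp: inj_def)
  moreover have "infinite (UNIV :: (int \<Rightarrow>\<^sub>0 'k) set)"
  proof -
    have "inj (\<lambda>i. xpow i :: int \<Rightarrow>\<^sub>0 'k)"
      by (rule injI) (metis lookup_single_eq lookup_single_not_eq zero_neq_one)
    then show ?thesis
      using finite_imageD[of "\<lambda>i. xpow i :: int \<Rightarrow>\<^sub>0 'k" UNIV] infinite_UNIV_int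
      by (meson finite_subset subset_UNIV)
  qed
  ultimately have "infinite (rcosets\<^bsub>add_group UNIV\<^esub> {0 :: int \<Rightarrow>\<^sub>0 'k})"
    unfolding rcosets_add_group using finite_imageD by blast
  then show ?thesis by simp
qed

text \<open>A nonzero constant coefficient of \<open>g\<close> makes division by \<open>x\<close>
  possible among polynomials modulo \<open>g\<close>, so negative powers can be removed one at a
  time.\<close>

lemma laur_ideal_representative:
  fixes r :: "int \<Rightarrow>\<^sub>0 'k::field"
  assumes g0: "poly.coeff g 0 \<noteq> 0"
  obtains q where "r - laur q \<in> laur_ideal g"
proof -
  let ?J = "laur_ideal g"
  have Jc: "add_closed ?J" and Jr: "\<And>r a. a \<in> ?J \<Longrightarrow> r * a \<in> ?J"
    using laur_ideal_in_ideals[of g] by (auto simp: ideals_def)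
  obtain n p where "xpow (int n) * r = laur p" by (rule xpow_mult_in_range_laur)
  then have "\<exists>q. r - laur q \<in> ?J"
  proof (induction n arbitrary: r)
    case 0
    then have "r - laur p = 0" by simp
    then show ?case using add_closedD(1)[OF Jc] by metis
  next
    case (Suc n)
    then have "xpow (int n) * (xpow 1 * r) = laur p" by (simp add: mult.assoc[symmetric] mult_single add.commute)
    then obtain q where q: "xpow 1 * r - laur q \<in> ?J" using Suc(1) by blast
    \<comment> \<open>The multiple of \<open>g\<close> is chosen to cancel the constant coefficient
      of \<open>q\<close>, so that \<open>s\<close> is divisible by \<open>x\<close> and stays in
      the class of \<open>q\<close>.\<close>
    define s where "s = q - Polynomial.smult (poly.coeff q 0 / poly.coeff g 0) g"
    have "poly.coeff s 0 = 0" using g0 by (simp add: s_def)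
    then obtain u where u: "s = pCons 0 u" by (metis pCons_cases coeff_pCons_0)
    have "laur (q - s) \<in> ?J"
      unfolding laur_in_laur_ideal_iff[OF g0] by (simp add: s_def dvd_smult)
    then have "(xpow 1 * r - laur q) + laur (q - s) \<in> ?J" by (rule add_closedD(4)[OF Jc q])
    then have "xpow 1 * r - xpow 1 * laur u \<in> ?J" by (simp add: laur_diff u laur_pCons_0)
    then have "xpow (- 1) * (xpow 1 * r - xpow 1 * laur u) \<in> ?J" by (rule Jr)
    then have "r - laur u \<in> ?J" by (simp only: right_diff_distrib xpow_cancel)
    then show ?case by blast
  qed
  then show ?thesis using that by blast
qed

text \<open>The quotient is \<open>k[x]\<close> modulo \<open>g\<close>: the remainders of degree
  below that of \<open>g\<close> represent each class exactly once.\<close>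

lemma add_index_laur_ideal:
  fixes g :: "'k::{field, finite} poly"
  assumes g: "monic g" "poly.coeff g 0 \<noteq> 0"
  shows "add_index UNIV (laur_ideal g) = CARD('k) ^ degree g"
proof -
  let ?J = "laur_ideal g" and ?S = "{q. \<forall>i\<ge>degree g. poly.coeff q i = 0}"
  have Jc: "add_closed ?J" using laur_ideal_in_ideals[of g] by (auto simp: ideals_def)
  have small: "q = 0" if "q \<in> ?S" "g dvd q" for q
  proof (rule ccontr)
    assume "q \<noteq> 0"
    then have "degree g \<le> degree q" by (rule dvd_imp_degree_le[OF that(2)])
    then show False using that(1) \<open>q \<noteq> 0\<close> by auto
  qed
  have "bij_betw (\<lambda>q. {w. w - laur q \<in> ?J}) ?S (rcosets\<^bsub>add_group UNIV\<^esub> ?J)"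
  proof (rule bij_betw_imageI)
    show "inj_on (\<lambda>q. {w. w - laur q \<in> ?J}) ?S"
    proof (rule inj_onI)
      fix p q assume pq: "p \<in> ?S" "q \<in> ?S" "{w. w - laur p \<in> ?J} = {w. w - laur q \<in> ?J}"
      then have "g dvd p - q"
        by (simp add: add_cosets_eq_iff[OF Jc] laur_diff[symmetric] laur_in_laur_ideal_iff[OF g(2)])
      then have "p - q = 0" using pq by (intro small) auto
      then show "p = q" by simp
    qed
    show "(\<lambda>q. {w. w - laur q \<in> ?J}) ` ?S = rcosets\<^bsub>add_group UNIV\<^esub> ?J"
    proof (intro equalityI subsetI)
      fix C assume "C \<in> rcosets\<^bsub>add_group UNIV\<^esub> ?J"
      then obtain r where C: "C = {w. w - r \<in> ?J}" by (auto simp: rcosets_add_group)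
      obtain p where p: "r - laur p \<in> ?J" using laur_ideal_representative[OF g(2)] by blast
      have "g \<noteq> 0" using g by auto
      have "p mod g \<in> ?S"
        using degree_mod_less[OF \<open>g \<noteq> 0\<close>, of p] by (auto intro: coeff_eq_0)
      moreover have "laur (p - p mod g) \<in> ?J"
        by (simp add: laur_in_laur_ideal_iff[OF g(2)] minus_mod_eq_mult_div)
      then have "(r - laur p) + laur (p - p mod g) \<in> ?J" by (rule add_closedD(4)[OF Jc p])
      then have "r - laur (p mod g) \<in> ?J" by (simp add: laur_diff)
      then have "C = {w. w - laur (p mod g) \<in> ?J}" unfolding C by (subst add_cosets_eq_iff[OF Jc])
      ultimately show "C \<in> (\<lambda>q. {w. w - laur q \<in> ?J}) ` ?S" by blast
    qed (auto simp: rcosets_add_group)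
  qed
  from bij_betw_same_card[OF this] show ?thesis using card_polys_below[where ?'k='k, of "degree g"] by simp
qed

lemma ideal_of_pos_index:
  fixes J :: "(int \<Rightarrow>\<^sub>0 'k::{field, finite}) set"
  assumes "J \<in> ideals" "add_index UNIV J > 0"
  obtains g where "monic g" "poly.coeff g 0 \<noteq> 0" "J = laur_ideal g" "add_index UNIV J = CARD('k) ^ degree g"
proof -
  have "J \<noteq> {0}" using assms(2) by (auto simp: add_index_zero_ideal)
  then obtain g where g: "monic g" "poly.coeff g 0 \<noteq> 0" "J = laur_ideal g"
    using ideal_eq_laur_ideal[OF assms(1)] by metis
  then show ?thesis using that add_index_laur_ideal[OF g(1,2)] by simp
qed

lemma card_field_gt_1: "1 < CARD('k::{field, finite})"
proof -
  have "card {0, 1 :: 'k} \<le> CARD('k)" by (rule card_mono) auto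
  then show ?thesis by simp
qed

text \<open>The ideals correspond to their normalised generators, with the index turned into the
  degree. Degree 0 leaves only the generator 1; for positive \<open>t\<close> the value is
  \<open>CARD('k) ^ t - CARD('k) ^ (t - 1)\<close>.\<close>

lemma card_ideals_index:
  fixes t :: nat
  defines "I \<equiv> {J \<in> ideals :: (int \<Rightarrow>\<^sub>0 'k::{field, finite}) set set. add_index UNIV J = CARD('k) ^ t}"
  shows "finite I" "card I = (if t = 0 then 1 else (CARD('k) - 1) * CARD('k) ^ (t - 1))"
proof -
  let ?S = "{g :: 'k poly. monic g \<and> degree g = t \<and> poly.coeff g 0 \<noteq> 0}"
  note gt1 = card_field_gt_1[where ?'k='k]
  have bij: "bij_betw laur_ideal ?S I"
  proof (rule bij_betw_imageI)
    show "inj_on laur_ideal ?S" using laur_ideal_inj by (auto simp: inj_on_def)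
    show "laur_ideal ` ?S = I"
    proof (intro equalityI subsetI)
      fix J assume "J \<in> I"
      then have J: "J \<in> ideals" "add_index UNIV J = CARD('k) ^ t" by (auto simp: I_def)
      then obtain g where g: "monic g" "poly.coeff g 0 \<noteq> 0" "J = laur_ideal g"
          "add_index UNIV J = CARD('k) ^ degree g"
        using ideal_of_pos_index[OF J(1)] by (metis zero_less_power zero_less_card_finite)
      then have "degree g = t" using J(2) gt1 by (simp add: power_inject_exp)
      then show "J \<in> laur_ideal ` ?S" using g by blast
    qed (auto simp: I_def laur_ideal_in_ideals add_index_laur_ideal)
  qed
  have card: "card ?S = (if t = 0 then 1 else (CARD('k) - 1) * CARD('k) ^ (t - 1))"
  proof (cases t)
    case 0
    have "?S = {1}" by (auto simp: 0 one_pCons elim!: degree_eq_zeroE)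
    then show ?thesis using 0 by simp
  next
    case (Suc s)
    then show ?thesis using card_monic_polys_nonzero_const[where ?'k='k, of s] by simp
  qed
  \<comment> \<open>The count itself yields finiteness, since \<open>card\<close> of an infinite set
    is 0.\<close>
  then have "card ?S > 0" using gt1 by simp
  then have "finite ?S" by (rule card_ge_0_finite)
  then show "finite I" using bij_betw_finite[OF bij] by simp
  show "card I = (if t = 0 then 1 else (CARD('k) - 1) * CARD('k) ^ (t - 1))"
    using bij_betw_same_card[OF bij] card by simp
qed

section \<open>Counting submodules of finite index\<close>

text \<open>Submodules are sorted by their trace \<open>N\<close> on \<open>R ^ k\<close> and their
  last coordinate ideal \<open>J\<close>. Each pair is met exactly as often as the index
  \<open>d\<close> of \<open>N\<close>, whatever \<open>J\<close> is, and the index of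
  \<open>J\<close> is then \<open>q div d\<close>.\<close>

lemma finite_card_coord_submodules_Suc:
  fixes q :: nat
  assumes q: "q > 0"
    and principal: "\<And>J :: 'r::idom set. J \<in> ideals \<Longrightarrow> add_index UNIV J > 0 \<Longrightarrow> \<exists>a. a \<noteq> 0 \<and> J = range (\<lambda>r. r * a)"
    and fin_ideals: "\<And>e. e > 0 \<Longrightarrow> finite {J \<in> ideals :: 'r set set. add_index UNIV J = e}"
    and fin_sub: "\<And>e. e > 0 \<Longrightarrow> finite {N \<in> coord_submodules k :: (nat \<Rightarrow> 'r) set set. add_index (coord_space k) N = e}"
  defines "S \<equiv> {M \<in> coord_submodules (Suc k) :: (nat \<Rightarrow> 'r) set set. add_index (coord_space (Suc k)) M = q}"
  shows "finite S"
    and "card S = (\<Sum>d | d dvd q. card {N \<in> coord_submodules k :: (nat \<Rightarrow> 'r) set set. add_index (coord_space k) N = d}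
      * d * card {J \<in> ideals :: 'r set set. add_index UNIV J = q div d})"
proof -
  let ?A = "\<lambda>d. {N \<in> coord_submodules k :: (nat \<Rightarrow> 'r) set set. add_index (coord_space k) N = d}"
  let ?B = "\<lambda>d. {J \<in> ideals :: 'r set set. add_index UNIV J = q div d}"
  define F where "F = (\<lambda>(N, J). {M \<in> coord_submodules (Suc k) :: (nat \<Rightarrow> 'r) set set.
      M \<inter> coord_space k = N \<and> (\<lambda>f. f k) ` M = J})"
  \<comment> \<open>The entry \<open>d\<close> is the index of \<open>N\<close>, carried along so
    that the sum can be grouped by divisors of \<open>q\<close>.\<close>
  define T where "T = (SIGMA d:{d. d dvd q}. ?A d \<times> ?B d)"
  have dpos: "0 < d" "0 < q div d" if "d dvd q" for d
    using that q by (auto intro: Nat.gr0I dest: dvd_div_eq_0_iff[THEN iffD1])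
  have fin_div: "finite {d. d dvd q}" using q by simp
  have finT: "finite T"
    unfolding T_def by (intro finite_SigmaI fin_div finite_cartesian_product fin_sub fin_ideals) (auto simp: dpos)
  have cardF: "finite (F (N, J)) \<and> card (F (N, J)) = d" if "(d, N, J) \<in> T" for d N J
  proof -
    have N: "N \<in> coord_submodules k" "add_index (coord_space k) N = d" and J: "J \<in> ideals" "add_index UNIV J = q div d"
      and d: "d dvd q" using that by (auto simp: T_def)
    obtain a where a: "a \<noteq> 0" "J = range (\<lambda>r. r * a)" using principal J dpos[OF d] by metis
    note bij = bij_betw_coord_submodules_fibre[OF N(1) a(1)]
    have "card (F (N, J)) = d"
      using bij_betw_same_card[OF bij] N(2) by (simp add: F_def a)
    then show ?thesis using dpos(1)[OF d] card_ge_0_finite by metis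
  qed
  have S: "S = (\<Union>(d, NJ)\<in>T. F NJ)"
  proof (intro equalityI subsetI)
    fix M assume M: "M \<in> S"
    then have M1: "M \<in> coord_submodules (Suc k)" by (simp add: S_def)
    note * = coord_submodule_index[OF M1]
    let ?d = "add_index (coord_space k) (M \<inter> coord_space k)"
    have prod: "q = ?d * add_index UNIV ((\<lambda>f. f k) ` M)" using * M by (simp add: S_def)
    then have "?d > 0" using q by (metis mult_is_0 not_gr_zero)
    then have "add_index UNIV ((\<lambda>f. f k) ` M) = q div ?d" using prod by (metis nonzero_mult_div_cancel_left not_gr_zero)
    moreover have "?d dvd q" using prod by (metis dvd_triv_left)
    ultimately have "(?d, M \<inter> coord_space k, (\<lambda>f. f k) ` M) \<in> T" using * by (simp add: T_def)
    moreover have "M \<in> F (M \<inter> coord_space k, (\<lambda>f. f k) ` M)" using M1 by (simp add: F_def)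
    ultimately show "M \<in> (\<Union>(d, NJ)\<in>T. F NJ)" by blast
  next
    fix M assume "M \<in> (\<Union>(d, NJ)\<in>T. F NJ)"
    then obtain d N J where T: "(d, N, J) \<in> T" and M: "M \<in> F (N, J)" by auto
    then have M1: "M \<in> coord_submodules (Suc k)" by (simp add: F_def)
    then show "M \<in> S"
      using T M coord_submodule_index(3)[OF M1] by (auto simp: S_def F_def T_def)
  qed
  have disj: "\<forall>x\<in>T. \<forall>y\<in>T. x \<noteq> y \<longrightarrow> F (snd x) \<inter> F (snd y) = {}"
    by (auto simp: F_def T_def)
  have S': "S = (\<Union>x\<in>T. F (snd x))" unfolding S by auto
  show "finite S" unfolding S' by (intro finite_UN_I finT) (auto dest: cardF)
  have "card S = (\<Sum>x\<in>T. card (F (snd x)))"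
    unfolding S' by (rule card_UN_disjoint[OF finT _ disj]) (auto dest: cardF)
  also have "\<dots> = (\<Sum>x\<in>T. fst x)"
    by (rule sum.cong) (auto dest: cardF)
  also have "\<dots> = (\<Sum>d | d dvd q. \<Sum>x\<in>?A d \<times> ?B d. d)"
    unfolding T_def by (subst sum.Sigma) (auto intro!: fin_div finite_cartesian_product fin_sub fin_ideals sum.cong simp: dpos)
  also have "\<dots> = (\<Sum>d | d dvd q. card (?A d) * d * card (?B d))"
    by (rule sum.cong) (auto simp: card_cartesian_product)
  finally show "card S = (\<Sum>d | d dvd q. card (?A d) * d * card (?B d))" .
qed

text \<open>The terms with \<open>i < t\<close> telescope to \<open>Q ^ (k * (t - 1)) * (Q ^ t - Q ^ (t - 1))\<close>.\<close>

lemma submodule_count_recursion: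
  fixes Q :: int and k t :: nat
  defines "b \<equiv> \<lambda>k t. if t = 0 then 1 else Q ^ (k * t) - Q ^ (k * (t - 1))"
  shows "(\<Sum>i\<le>t. b k i * Q ^ i * b 1 (t - i)) = b (Suc k) t"
proof (cases t)
  case 0
  then show ?thesis by (simp add: b_def)
next
  case (Suc s)
  have part: "(\<Sum>i\<le>j. b k i * Q ^ i * b 1 (Suc s - i)) = Q ^ (k * j) * (Q ^ Suc s - Q ^ s)" if "j \<le> s" for j
    using that
  proof (induction j)
    case 0
    then show ?case by (simp add: b_def)
  next
    case (Suc j)
    obtain d where d: "s = Suc j + d" using Suc(2) le_Suc_ex by blast
    have "b k (Suc j) * Q ^ Suc j * b 1 (Suc s - Suc j) = (Q ^ (k * Suc j) - Q ^ (k * j)) * (Q ^ Suc s - Q ^ s)"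
      by (simp add: b_def d power_add algebra_simps)
    then show ?case using Suc by (simp add: algebra_simps)
  qed
  \<comment> \<open>The last term stands apart because \<open>b 1 0\<close> is 1 and not a
    difference of powers.\<close>
  have "(\<Sum>i\<le>Suc s. b k i * Q ^ i * b 1 (Suc s - i)) = Q ^ (k * s) * (Q ^ Suc s - Q ^ s) + b k (Suc s) * Q ^ Suc s"
    using part[of s] by (simp add: b_def)
  also have "\<dots> = b (Suc k) (Suc s)"
    by (simp add: b_def algebra_simps power_add)
  finally show ?thesis using Suc by simp
qed

text \<open>The step to \<open>Suc k\<close> sums over all divisors of \<open>q\<close>, so the
  values at powers, the absence of other indices and finiteness have to pass through the induction
  together. Over \<open>int\<close> the difference of powers is a true subtraction.\<close>

theorem card_coord_submodules:
  fixes k q :: nat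
  defines "S \<equiv> \<lambda>k q. {M \<in> coord_submodules k :: (nat \<Rightarrow> int \<Rightarrow>\<^sub>0 'k::{field, finite}) set set. add_index (coord_space k) M = q}"
  assumes "q > 0"
  shows "finite (S k q) \<and>
    (q \<notin> range (\<lambda>t. CARD('k) ^ t) \<longrightarrow> S k q = {}) \<and>
    (\<forall>t. q = CARD('k) ^ t \<longrightarrow> int (card (S k q)) =
      (if t = 0 then 1 else int CARD('k) ^ (k * t) - int CARD('k) ^ (k * (t - 1))))"
  using \<open>q > 0\<close>
proof (induction k arbitrary: q)
  case 0
  have sp: "coord_space 0 = {0 :: nat \<Rightarrow> int \<Rightarrow>\<^sub>0 'k}" by (auto simp: coord_space_def)
  have "coord_submodules 0 = {{0 :: nat \<Rightarrow> int \<Rightarrow>\<^sub>0 'k}}"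
    by (auto simp: coord_submodules_def sp add_closed_def scale_def subset_singleton_iff zero_fun_def)
  moreover have "add_index (coord_space 0) {0 :: nat \<Rightarrow> int \<Rightarrow>\<^sub>0 'k} = 1"
    by (simp add: rcosets_add_group sp)
  ultimately have "S 0 q = (if q = 1 then {{0}} else {})" by (auto simp: S_def)
  moreover have t0: "t = 0" if "CARD('k) ^ t = 1" for t
    using one_less_power[OF card_field_gt_1[where ?'k='k], of t] that by (cases "t = 0") auto
  have "1 \<in> range (\<lambda>t. CARD('k) ^ t)" by (rule range_eqI[of _ _ 0]) simp
  ultimately show ?case
  proof (cases "q = 1")
    case True
    then have S1: "S 0 q = {{0}}" "q \<in> range (\<lambda>t. CARD('k) ^ t)"
      using \<open>S 0 q = _\<close> \<open>1 \<in> _\<close> by simp_all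
    have "int (card (S 0 q)) = 1" by (simp add: S1(1))
    moreover have "t = 0" if "q = CARD('k) ^ t" for t using t0 that True by metis
    ultimately show ?thesis using S1 by (metis finite.intros)
  next
    case False
    then have "S 0 q = {}" using \<open>S 0 q = _\<close> by simp
    moreover have "int (card (S 0 q)) = 0" by (simp add: calculation)
    moreover have "t \<noteq> 0" if "q = CARD('k) ^ t" for t using that False by auto
    \<comment> \<open>In rank 0 there is only the zero module, and the closed form gives
      \<open>1 - 1\<close> for positive \<open>t\<close>.\<close>
    moreover have "int CARD('k) ^ (0 * t) - int CARD('k) ^ (0 * (t - 1)) = 0" for t by simp
    ultimately show ?thesis by (metis finite.emptyI)
  qed
next
  case (Suc k)
  let ?Q = "CARD('k)"
  note gt1 = card_field_gt_1[where ?'k='k]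
  let ?I = "\<lambda>e. {J \<in> ideals :: (int \<Rightarrow>\<^sub>0 'k) set set. add_index UNIV J = e}"
  let ?b = "\<lambda>k t. if t = 0 then 1 else int ?Q ^ (k * t) - int ?Q ^ (k * (t - 1))"
  have Iempty: "?I e = {}" if "e > 0" "e \<notin> range (\<lambda>t. ?Q ^ t)" for e
    using that ideal_of_pos_index by (metis (mono_tags, lifting) empty_Collect_eq rangeI)
  have Ifin: "finite (?I e)" if "e > 0" for e
  proof (cases "e \<in> range (\<lambda>t. ?Q ^ t)")
    case True
    then show ?thesis using card_ideals_index(1)[where ?'k='k] by blast
  next
    case False
    show ?thesis unfolding Iempty[OF that False] by simp
  qed
  \<comment> \<open>Ideals obey the closed form of rank 1, which is the factor
    \<open>b 1 (t - i)\<close> of \<open>submodule_count_recursion\<close>.\<close>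
  have Icard: "int (card (?I (?Q ^ t))) = ?b 1 t" for t
    using gt1 unfolding card_ideals_index(2) by (cases t) (auto simp: of_nat_diff algebra_simps)
  have principal: "\<exists>a. a \<noteq> 0 \<and> J = range (\<lambda>r. r * a)" if "J \<in> ideals" "add_index UNIV J > 0" for J :: "(int \<Rightarrow>\<^sub>0 'k) set"
    using ideal_of_pos_index[OF that] by (metis laur_eq_0_iff laur_ideal_def coeff_0)
  note rec = finite_card_coord_submodules_Suc[where k = k and ?'r = "int \<Rightarrow>\<^sub>0 'k", OF _ principal Ifin, folded S_def]
  have IH: "finite (S k e)" "e \<notin> range (\<lambda>t. ?Q ^ t) \<Longrightarrow> S k e = {}" if "e > 0" for e
    using Suc.IH[OF that] by auto
  have IHc: "int (card (S k (?Q ^ t))) = ?b k t" for t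
    using Suc.IH[of "?Q ^ t"] gt1 by auto
  have fin: "finite (S (Suc k) q)"
    using rec(1)[OF Suc.prems] IH(1) by (simp add: S_def)
  have card: "card (S (Suc k) q) = (\<Sum>d | d dvd q. card (S k d) * d * card (?I (q div d)))"
    using rec(2)[OF Suc.prems] IH(1) by (simp add: S_def)
  \<comment> \<open>A term survives only if \<open>d\<close> and \<open>q div d\<close> are both
    powers of \<open>?Q\<close>, and then \<open>q\<close> is one as well.\<close>
  have zero: "card (S k d) * d * card (?I (q div d)) = 0"
    if "d dvd q" "\<not> (\<exists>i j. d = ?Q ^ i \<and> q div d = ?Q ^ j)" for d
  proof -
    have "d > 0" "q div d > 0" using that(1) Suc.prems by (auto intro: Nat.gr0I dest: dvd_div_eq_0_iff[THEN iffD1])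
    then have "S k d = {} \<or> ?I (q div d) = {}" using that(2) IH(2) Iempty by blast
    then show ?thesis
    proof
      assume I: "?I (q div d) = {}"
      show ?thesis unfolding I by simp
    qed simp
  qed
  have "S (Suc k) q = {}" if "q \<notin> range (\<lambda>t. ?Q ^ t)"
  proof -
    have "card (S k d) * d * card (?I (q div d)) = 0" if d: "d dvd q" for d
    proof (rule zero[OF d], rule notI)
      assume "\<exists>i j. d = ?Q ^ i \<and> q div d = ?Q ^ j"
      then obtain i j where "d = ?Q ^ i" "q div d = ?Q ^ j" by blast
      then have "q = ?Q ^ (i + j)" using d by (metis dvd_mult_div_cancel power_add)
      then show False using \<open>q \<notin> _\<close> by blast
    qed
    then have "card (S (Suc k) q) = 0" unfolding card by (intro sum.neutral) auto
    then show ?thesis using fin by simp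
  qed
  moreover have "int (card (S (Suc k) q)) = ?b (Suc k) t" if q: "q = ?Q ^ t" for t
  proof -
    have sub: "(\<lambda>i. ?Q ^ i) ` {..t} \<subseteq> {d. d dvd q}" by (auto simp: q intro: le_imp_power_dvd)
    have "card (S (Suc k) q) = (\<Sum>d\<in>(\<lambda>i. ?Q ^ i) ` {..t}. card (S k d) * d * card (?I (q div d)))"
      unfolding card
    proof (rule sum.mono_neutral_right[OF _ sub])
      show "finite {d. d dvd q}" using Suc.prems by simp
      show "\<forall>d\<in>{d. d dvd q} - (\<lambda>i. ?Q ^ i) ` {..t}. card (S k d) * d * card (?I (q div d)) = 0"
      proof
        fix d assume d: "d \<in> {d. d dvd q} - (\<lambda>i. ?Q ^ i) ` {..t}"
        show "card (S k d) * d * card (?I (q div d)) = 0"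
        proof (rule zero)
          show "d dvd q" using d by simp
          show "\<not> (\<exists>i j. d = ?Q ^ i \<and> q div d = ?Q ^ j)"
          proof
            assume "\<exists>i j. d = ?Q ^ i \<and> q div d = ?Q ^ j"
            then obtain i where i: "d = ?Q ^ i" by blast
            then have "?Q ^ i \<le> ?Q ^ t" using d Suc.prems q by (auto intro: dvd_imp_le)
            then have "i \<le> t" using gt1 power_le_imp_le_exp by blast
            then show False using d i by blast
          qed
        qed
      qed
    qed
    also have "\<dots> = (\<Sum>i\<le>t. card (S k (?Q ^ i)) * ?Q ^ i * card (?I (q div ?Q ^ i)))"
      using gt1 by (subst sum.reindex) (auto simp: inj_on_def power_inject_exp)
    also have "\<dots> = (\<Sum>i\<le>t. card (S k (?Q ^ i)) * ?Q ^ i * card (?I (?Q ^ (t - i))))"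
      using gt1 by (intro sum.cong) (auto simp: q power_diff)
    finally have "int (card (S (Suc k) q)) = (\<Sum>i\<le>t. ?b k i * int ?Q ^ i * ?b 1 (t - i))"
      by (simp only: of_nat_sum of_nat_mult of_nat_power IHc Icard)
    then show ?thesis using submodule_count_recursion[where Q = "int ?Q" and k = k and t = t] by simp
  qed
  ultimately show ?case using fin by blast
qed

section \<open>Subgroups of a semidirect product with the integers\<close>

lemma integer_group_eq_add_group: "integer_group = add_group UNIV"
  by (simp add: integer_group_def add_group_def)

text \<open>The least positive element generates. The zero subgroup is excluded because its infinite
  index reads as 0.\<close>

lemma int_subgroup_cases:
  assumes K: "subgroup K integer_group" and idx: "card (rcosets\<^bsub>integer_group\<^esub> K) > 0"
  obtains d :: nat where "d > 0" "K = range (\<lambda>j. int d * j)"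
proof -
  have Kc: "add_closed K"
    using K by (simp add: integer_group_eq_add_group subgroup_add_group add_closed_UNIV)
  have "K \<noteq> {0}"
  proof
    assume K0: "K = {0}"
    have "inj (\<lambda>v::int. {w. w - v \<in> K})" by (auto simp: inj_def K0)
    then have "infinite (rcosets\<^bsub>integer_group\<^esub> K)"
      unfolding integer_group_eq_add_group rcosets_add_group using finite_imageD infinite_UNIV_int by blast
    then show False using idx by simp
  qed
  then obtain x where x: "x \<in> K" "x \<noteq> 0" using add_closedD(1)[OF Kc] by blast
  then have "int (nat \<bar>x\<bar>) \<in> K" using add_closedD(3)[OF Kc] by (auto simp: abs_if)
  define d where "d = (LEAST n. 0 < n \<and> int n \<in> K)"
  have d: "0 < d \<and> int d \<in> K"
    unfolding d_def by (rule LeastI[of _ "nat \<bar>x\<bar>"]) (use x \<open>int (nat \<bar>x\<bar>) \<in> K\<close> in auto)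
  have d_min: "\<not> (0 < n \<and> int n \<in> K)" if "n < d" for n
    using that not_less_Least unfolding d_def by blast
  have nat_mult: "int n * y \<in> K" if "y \<in> K" for n y
  proof (induction n)
    case 0
    then show ?case using add_closedD(1)[OF Kc] by simp
  next
    case (Suc n)
    then show ?case using add_closedD(4)[OF Kc that Suc] by (simp add: algebra_simps)
  qed
  have mult: "int d * j \<in> K" for j
    using nat_mult[of "int d" "nat j"] nat_mult[of "- int d" "nat (- j)"] add_closedD(3)[OF Kc, of "int d"] d
    by (cases "j \<ge> 0") (auto simp: mult.commute)
  have "K = range (\<lambda>j. int d * j)"
  proof (intro equalityI subsetI)
    fix y assume "y \<in> K"
    then have "y - int d * (y div int d) \<in> K" by (rule add_closedD(2)[OF Kc _ mult])
    then have "int (nat (y mod int d)) \<in> K" using d by (simp add: minus_mult_div_eq_mod)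
    moreover have "nat (y mod int d) < d" using d by (simp add: nat_less_iff)
    ultimately have "nat (y mod int d) = 0" using d_min[of "nat (y mod int d)"] by auto
    moreover have "y mod int d \<ge> 0" using d by simp
    ultimately have "y = int d * (y div int d)" using mult_div_mod_eq[of "int d" y] by linarith
    then show "y \<in> range (\<lambda>j. int d * j)" by blast
  qed (use mult in auto)
  then show ?thesis using that d by blast
qed

lemma card_rcosets_multiples:
  assumes "d > 0"
  shows "card (rcosets\<^bsub>integer_group\<^esub> (range (\<lambda>j. int d * j))) = d"
proof -
  let ?K = "range (\<lambda>j. int d * j)"
  have mem: "y \<in> ?K \<longleftrightarrow> y mod int d = 0" for y by (auto simp: mod_eq_0_iff_dvd elim!: dvdE)
  have "add_closed ?K" unfolding add_closed_def by (auto simp: mem mod_diff_eq)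
  note eq = add_cosets_eq_iff[OF this]
  have "bij_betw (\<lambda>v. {w. w - v \<in> ?K}) {0..<int d} (rcosets\<^bsub>integer_group\<^esub> ?K)"
    unfolding integer_group_eq_add_group rcosets_add_group
  proof (rule bij_betw_imageI)
    show "inj_on (\<lambda>v. {w. w - v \<in> ?K}) {0..<int d}"
    proof (rule inj_onI)
      fix v v' assume v: "v \<in> {0..<int d}" "v' \<in> {0..<int d}" "{w. w - v \<in> ?K} = {w. w - v' \<in> ?K}"
      have "v - v' \<in> ?K" using v(3) unfolding eq .
      then have "(v - v') mod int d = 0" unfolding mem .
      then have "v mod int d = v' mod int d" using mod_eq_dvd_iff mod_eq_0_iff_dvd by blast
      then show "v = v'" using v by simp
    qed
    show "(\<lambda>v. {w. w - v \<in> ?K}) ` {0..<int d} = range (\<lambda>v. {w. w - v \<in> ?K})"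
    proof (intro equalityI subsetI)
      fix C assume "C \<in> range (\<lambda>v. {w. w - v \<in> ?K})"
      then obtain v where C: "C = {w. w - v \<in> ?K}" by blast
      have "v - v mod int d \<in> ?K" unfolding mem by (simp add: minus_mod_eq_mult_div)
      then have "C = {w. w - v mod int d \<in> ?K}" unfolding C by (simp only: eq)
      moreover have "v mod int d \<in> {0..<int d}" using assms by simp
      ultimately show "C \<in> (\<lambda>v. {w. w - v \<in> ?K}) ` {0..<int d}" by blast
    qed auto
  qed
  from bij_betw_same_card[OF this] show ?thesis by simp
qed

text \<open>Sorting the subgroups uses only a commutative base with an action of the integers; the
  lamplighter group becomes an instance with \<open>shift\<close> as the action.\<close>

locale int_action = comm_group A for A (structure) +
  fixes \<phi> :: "int \<Rightarrow> 'a \<Rightarrow> 'a"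
  assumes act_hom: "\<phi> s \<in> hom A A"
    and act_zero: "x \<in> carrier A \<Longrightarrow> \<phi> 0 x = x"
    and act_add: "x \<in> carrier A \<Longrightarrow> \<phi> (s + t) x = \<phi> s (\<phi> t x)"
begin

definition G :: "('a \<times> int) monoid"
  where "G = semidirect_product A integer_group \<phi>"

lemma G_simps [simp]:
  "carrier G = carrier A \<times> UNIV" "\<one>\<^bsub>G\<^esub> = (\<one>, 0)"
  "x \<otimes>\<^bsub>G\<^esub> y = (fst x \<otimes> \<phi> (snd x) (fst y), snd x + snd y)"
  by (auto simp: G_def semidirect_product_def split: prod.splits)

lemma act_closed [simp]: "x \<in> carrier A \<Longrightarrow> \<phi> s x \<in> carrier A"
  using act_hom by (rule hom_in_carrier)

lemma act_mult [simp]: "x \<in> carrier A \<Longrightarrow> y \<in> carrier A \<Longrightarrow> \<phi> s (x \<otimes> y) = \<phi> s x \<otimes> \<phi> s y"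
  using act_hom by (rule hom_mult)

lemma act_cancel: "x \<in> carrier A \<Longrightarrow> \<phi> s (\<phi> (- s) x) = x" "x \<in> carrier A \<Longrightarrow> \<phi> (- s) (\<phi> s x) = x"
  using act_add[of x s "- s"] act_add[of x "- s" s] act_zero by simp_all

lemma act_one [simp]: "\<phi> s \<one> = \<one>"
  using hom_one[OF act_hom is_group is_group] .

lemma group_G: "group G"
proof (rule groupI)
  fix x assume "x \<in> carrier G"
  then show "\<exists>y\<in>carrier G. y \<otimes>\<^bsub>G\<^esub> x = \<one>\<^bsub>G\<^esub>"
    by (intro bexI[of _ "(\<phi> (- snd x) (inv fst x), - snd x)"])
      (auto simp: act_mult[symmetric] l_inv simp del: act_mult)
qed (auto simp: act_zero act_add m_assoc)

interpretation G: group G by (rule group_G)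

lemma hom_snd: "group_hom G integer_group snd"
  by (intro group_hom.intro group_hom_axioms.intro group_G group_integer_group) (auto simp: hom_def)

lemma snd_int_pow: "w \<in> carrier G \<Longrightarrow> snd (w [^]\<^bsub>G\<^esub> (j::int)) = snd w * j"
  using group_hom.hom_int_pow[OF hom_snd, of w j] by simp

text \<open>As \<open>A\<close> is commutative, conjugation of a base element by \<open>g\<close>
  sees only the integer component of \<open>g\<close>.\<close>

lemma conj_base: "g \<in> carrier G \<Longrightarrow> m \<in> carrier A \<Longrightarrow> g \<otimes>\<^bsub>G\<^esub> (m, 0) = (\<phi> (snd g) m, 0) \<otimes>\<^bsub>G\<^esub> g"
  by (auto simp: act_zero m_comm)

lemma inv_base: "m \<in> carrier A \<Longrightarrow> inv\<^bsub>G\<^esub> (m, 0) = (inv m, 0)"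
  by (rule G.inv_equality) (auto simp: act_zero)

definition base :: "('a \<times> int) set \<Rightarrow> 'a set"
  where "base H = {a \<in> carrier A. (a, 0) \<in> H}"

lemma subgroup_base:
  assumes H: "subgroup H G"
  shows "subgroup (base H) A"
proof (rule subgroupI)
  show "base H \<noteq> {}" using subgroup.one_closed[OF H] by (auto simp: base_def)
  show "inv a \<in> base H" if "a \<in> base H" for a
    using that subgroup.m_inv_closed[OF H, of "(a, 0)"] by (auto simp: base_def inv_base)
  show "a \<otimes> b \<in> base H" if "a \<in> base H" "b \<in> base H" for a b
    using that subgroup.m_closed[OF H, of "(a, 0)" "(b, 0)"] by (auto simp: base_def act_zero)
qed (auto simp: base_def)

text \<open>The projection \<open>snd\<close> is onto the integers and its kernel is a copy of
  \<open>A\<close>, so \<open>card_rcosets_hom\<close> splits the index.\<close>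

lemma card_rcosets_G:
  assumes H: "subgroup H G"
  shows "card (rcosets\<^bsub>G\<^esub> H) = card (rcosets (base H)) * card (rcosets\<^bsub>integer_group\<^esub> (snd ` H))"
proof -
  have surj: "snd ` carrier G = carrier integer_group"
    using one_closed by (force simp: image_iff)
  have ker: "kernel G integer_group snd = carrier A \<times> {0}" by (auto simp: kernel_def)
  let ?K = "G\<lparr>carrier := carrier A \<times> {0}\<rparr>"
  have iso: "(\<lambda>a. (a, 0)) \<in> iso A ?K"
    by (auto simp: iso_def hom_def bij_betw_def inj_on_def act_zero)
  have "H \<inter> carrier A \<times> {0} = (\<lambda>a. (a, 0)) ` base H" by (auto simp: base_def)
  then have "card (rcosets\<^bsub>?K\<^esub> (H \<inter> carrier A \<times> {0})) = card (rcosets (base H))"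
    using card_rcosets_iso[OF iso _ is_group, of "base H"] by (simp add: base_def)
  then show ?thesis using card_rcosets_hom[OF hom_snd surj H] by (simp add: ker)
qed

text \<open>Conjugation by \<open>g\<close> preserves both \<open>H\<close> and the base, and on the
  base it is the action of \<open>snd g\<close>. The inverse of \<open>g\<close> turns the inclusion
  into an equality.\<close>

lemma act_base:
  assumes H: "subgroup H G" and g: "g \<in> H"
  shows "\<phi> (snd g) ` base H = base H"
proof -
  have sub: "\<phi> (snd h) m \<in> base H" if "h \<in> H" "m \<in> base H" for h m
  proof -
    have hG: "h \<in> carrier G" and mA: "m \<in> carrier A" "(m, 0) \<in> H"
      using that subgroup.mem_carrier[OF H] by (auto simp: base_def)
    have c: "(\<phi> (snd h) m, 0) \<in> carrier G" using mA by simp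
    have "(\<phi> (snd h) m, 0) = (\<phi> (snd h) m, 0) \<otimes>\<^bsub>G\<^esub> h \<otimes>\<^bsub>G\<^esub> inv\<^bsub>G\<^esub> h"
      using hG c by (simp add: G.m_assoc del: G_simps)
    also have "\<dots> = h \<otimes>\<^bsub>G\<^esub> (m, 0) \<otimes>\<^bsub>G\<^esub> inv\<^bsub>G\<^esub> h"
      using conj_base[OF hG mA(1)] by simp
    also have "\<dots> \<in> H"
      using that mA by (intro subgroup.m_closed[OF H] subgroup.m_inv_closed[OF H])
    finally show ?thesis using mA by (simp add: base_def)
  qed
  have inv_g: "inv\<^bsub>G\<^esub> g \<in> H" using subgroup.m_inv_closed[OF H g] .
  have gG: "g \<in> carrier G" by (rule subgroup.mem_carrier[OF H g])
  have "snd (inv\<^bsub>G\<^esub> g) = - snd g"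
    using group_hom.hom_inv[OF hom_snd gG] by simp
  then have sub': "\<phi> (- snd g) m \<in> base H" if "m \<in> base H" for m using sub[OF inv_g that] by simp
  show ?thesis
  proof (intro equalityI subsetI)
    fix m assume m: "m \<in> base H"
    then have "m = \<phi> (snd g) (\<phi> (- snd g) m)" by (simp add: act_cancel base_def)
    then show "m \<in> \<phi> (snd g) ` base H" using sub'[OF m] by blast
  qed (use sub[OF g] in auto)
qed

text \<open>Equality in the hypothesis, rather than inclusion, provides invariance under
  \<open>- d\<close> and so covers negative \<open>j\<close>.\<close>

lemma act_multiple:
  assumes M: "M \<subseteq> carrier A" and inv: "\<phi> d ` M = M" and m: "m \<in> M"
  shows "\<phi> (d * j) m \<in> M"
proof -
  have pos: "\<phi> (e * int n) m \<in> M" if e: "\<And>x. x \<in> M \<Longrightarrow> \<phi> e x \<in> M" for e n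
  proof (induction n)
    case 0
    then show ?case using m M by (auto simp: act_zero)
  next
    case (Suc n)
    have "\<phi> (e * int (Suc n)) m = \<phi> e (\<phi> (e * int n) m)"
      using m M by (subst act_add[symmetric]) (auto simp: algebra_simps)
    then show ?case using e[OF Suc] by simp
  qed
  have plus: "\<phi> d x \<in> M" if "x \<in> M" for x
    using imageI[OF that, of "\<phi> d"] unfolding inv .
  have minus: "\<phi> (- d) x \<in> M" if "x \<in> M" for x
  proof -
    from that have "x \<in> \<phi> d ` M" unfolding inv .
    then obtain y where y: "x = \<phi> d y" "y \<in> M" by (rule imageE)
    then have "\<phi> (- d) x = y" using M act_cancel(2)[of y d] by blast
    then show ?thesis using y(2) by simp
  qed
  show ?thesis
  proof (cases "j \<ge> 0")
    case True
    then show ?thesis using pos[OF plus, of "nat j"] by simp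
  next
    case False
    then show ?thesis using pos[OF minus, of "nat (- j)"] by simp
  qed
qed

text \<open>A subgroup with given intersection \<open>M\<close> with the base group and given image \<open>d\<int>\<close> is generated by
  \<open>M\<close> and any of its elements over \<open>d\<close>; these elements form one coset of \<open>M\<close>.\<close>

lemma bij_betw_subgroups_fibre:
  assumes M: "subgroup M A" and inv: "\<phi> d ` M = M" and d: "d > 0"
  defines "F \<equiv> {H. subgroup H G \<and> base H = M \<and> snd ` H = range (\<lambda>j. d * j)}"
  shows "bij_betw (\<lambda>H. {a \<in> carrier A. (a, d) \<in> H}) F (rcosets M)"
proof (rule bij_betw_imageI)
  let ?\<Psi> = "\<lambda>H. {a \<in> carrier A. (a, d) \<in> H}"
  have Msub: "M \<subseteq> carrier A" by (rule subgroup.subset[OF M])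
  have inv_lift: "inv\<^bsub>G\<^esub> (a, d) = (\<phi> (- d) (inv a), - d)" if "a \<in> carrier A" for a
    using that by (intro G.inv_equality) (auto simp: act_mult[symmetric] l_inv simp del: act_mult)
  \<comment> \<open>Two elements of \<open>H\<close> over \<open>d\<close> differ by a base element
    of \<open>H\<close>, so those elements form one coset of \<open>M\<close>.\<close>
  have slice: "?\<Psi> H = M #> a" if H: "subgroup H G" "base H = M" and a: "(a, d) \<in> H" for H a
  proof -
    have aA: "a \<in> carrier A" using subgroup.mem_carrier[OF H(1) a] by simp
    have "(b, d) \<in> H \<longleftrightarrow> b \<in> M #> a" if b: "b \<in> carrier A" for b
    proof -
      have *: "(b, d) \<otimes>\<^bsub>G\<^esub> inv\<^bsub>G\<^esub> (a, d) = (b \<otimes> inv a, 0)"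
        using aA b by (simp add: inv_lift act_cancel)
      have "(b, d) \<in> H \<longleftrightarrow> (b \<otimes> inv a, 0) \<in> H"
      proof
        assume "(b, d) \<in> H"
        then show "(b \<otimes> inv a, 0) \<in> H"
          using subgroup.m_closed[OF H(1) _ subgroup.m_inv_closed[OF H(1) a]] * by metis
      next
        assume "(b \<otimes> inv a, 0) \<in> H"
        from subgroup.m_closed[OF H(1) this a] show "(b, d) \<in> H"
          using aA b by (simp add: act_zero m_assoc)
      qed
      also have "\<dots> \<longleftrightarrow> b \<otimes> inv a \<in> M" using H(2) aA b by (auto simp: base_def)
      also have "\<dots> \<longleftrightarrow> b \<in> M #> a" using subgroup.rcos_module[OF M is_group aA b] by simp
      finally show ?thesis .
    qed
    moreover have "M #> a \<subseteq> carrier A" by (rule r_coset_subset_G[OF Msub aA])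
    ultimately show ?thesis by blast
  qed
  have ex: "\<exists>a. (a, d) \<in> H" if "H \<in> F" for H
  proof -
    have "d * 1 \<in> snd ` H" using that unfolding F_def by blast
    then show ?thesis by force
  qed
  show "inj_on ?\<Psi> F"
  proof -
    have "H \<subseteq> H'" if H: "H \<in> F" and H': "H' \<in> F" and eq: "?\<Psi> H = ?\<Psi> H'" for H H'
    proof
      fix h assume h: "h \<in> H"
      have HG: "subgroup H G" "subgroup H' G" using H H' by (auto simp: F_def)
      obtain a where a: "(a, d) \<in> H" using ex[OF H] by blast
      let ?w = "(a, d)"
      have wG: "?w \<in> carrier G" by (rule subgroup.mem_carrier[OF HG(1) a])
      have hG: "h \<in> carrier G" by (rule subgroup.mem_carrier[OF HG(1) h])
      have w': "?w \<in> H'" using a eq wG by auto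
      have "snd h \<in> range (\<lambda>j. d * j)" using h H by (auto simp: F_def)
      then obtain j where j: "snd h = d * j" by blast
      \<comment> \<open>Dividing by the matching power of the common element over \<open>d\<close>
        brings \<open>h\<close> into the base, where \<open>H\<close> and \<open>H'\<close>
        agree.\<close>
      let ?k = "h \<otimes>\<^bsub>G\<^esub> (?w [^]\<^bsub>G\<^esub> (- j))"
      have k: "?k \<in> H"
        by (intro subgroup.m_closed[OF HG(1) h] G.subgroup_int_pow_closed[OF HG(1) a])
      have "snd ?k = 0" using snd_int_pow[OF wG, of "- j"] j by simp
      then have "?k = (fst ?k, 0)" by (simp add: prod_eq_iff)
      moreover have "fst ?k \<in> carrier A" using subgroup.mem_carrier[OF HG(1) k] by (simp add: mem_Times_iff del: G_simps(3))
      ultimately have "fst ?k \<in> base H" using k by (simp add: base_def del: G_simps(3))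
      then have "fst ?k \<in> base H'" using H H' by (simp add: F_def del: G_simps(3))
      then have "?k \<in> H'" using \<open>?k = (fst ?k, 0)\<close> by (simp add: base_def del: G_simps(3))
      then have "?k \<otimes>\<^bsub>G\<^esub> (?w [^]\<^bsub>G\<^esub> j) \<in> H'"
        by (rule subgroup.m_closed[OF HG(2) _ G.subgroup_int_pow_closed[OF HG(2) w']])
      moreover have eq: "?k \<otimes>\<^bsub>G\<^esub> (?w [^]\<^bsub>G\<^esub> j) = h"
      proof -
        have "?k \<otimes>\<^bsub>G\<^esub> (?w [^]\<^bsub>G\<^esub> j) = h \<otimes>\<^bsub>G\<^esub> (?w [^]\<^bsub>G\<^esub> (- j) \<otimes>\<^bsub>G\<^esub> (?w [^]\<^bsub>G\<^esub> j))"
          by (rule G.m_assoc[OF hG G.int_pow_closed[OF wG] G.int_pow_closed[OF wG]])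
        also have "?w [^]\<^bsub>G\<^esub> (- j) \<otimes>\<^bsub>G\<^esub> (?w [^]\<^bsub>G\<^esub> j) = \<one>\<^bsub>G\<^esub>"
          unfolding G.int_pow_mult[OF wG, symmetric] by (simp del: G_simps)
        also have "h \<otimes>\<^bsub>G\<^esub> \<one>\<^bsub>G\<^esub> = h" by (rule G.r_one[OF hG])
        finally show ?thesis .
      qed
      ultimately show "h \<in> H'" unfolding eq by blast
    qed
    note le = this
    show ?thesis
    proof (rule inj_onI)
      fix H H' assume "H \<in> F" "H' \<in> F" "?\<Psi> H = ?\<Psi> H'"
      then show "H = H'" using le[of H H'] le[of H' H] by (intro equalityI) simp_all
    qed
  qed
  show "?\<Psi> ` F = rcosets M"
  proof (intro equalityI subsetI)
    fix C assume "C \<in> ?\<Psi> ` F"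
    then obtain H where H: "H \<in> F" "C = ?\<Psi> H" by blast
    obtain a where a: "(a, d) \<in> H" using ex[OF H(1)] by blast
    have HG: "subgroup H G" "base H = M" using H(1) by (simp_all add: F_def)
    have "a \<in> carrier A" using subgroup.mem_carrier[OF HG(1) a] by simp
    then show "C \<in> rcosets M"
      unfolding H(2) slice[OF HG a] by (rule rcosetsI[OF Msub])
  next
    fix C assume "C \<in> rcosets M"
    then obtain v where v: "v \<in> carrier A" and C: "C = M #> v"
      unfolding RCOSETS_def by blast
    let ?w = "(v, d)"
    have wG: "?w \<in> carrier G" using v by simp
    let ?p = "\<lambda>j::int. ?w [^]\<^bsub>G\<^esub> j"
    have pG: "?p j \<in> carrier G" for j by (rule G.int_pow_closed[OF wG])
    have ps: "snd (?p j) = d * j" for j using snd_int_pow[OF wG, of j] by simp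
    \<comment> \<open>The normal form is an element of \<open>M\<close> times a power of
      \<open>?w\<close>. Products and inverses return to it through \<open>move\<close> and
      \<open>act\<close>, that is, because \<open>M\<close> is invariant under all multiples of
      \<open>d\<close>.\<close>
    define H where "H = {(m, 0) \<otimes>\<^bsub>G\<^esub> ?p j | m j. m \<in> M}"
    have HI: "(m, 0) \<otimes>\<^bsub>G\<^esub> ?p j \<in> H" if "m \<in> M" for m j using that by (auto simp: H_def)
    have MG: "(m, 0) \<in> carrier G" if "m \<in> M" for m using that Msub by auto
    have move: "?p j \<otimes>\<^bsub>G\<^esub> (m, 0) = (\<phi> (d * j) m, 0) \<otimes>\<^bsub>G\<^esub> ?p j" if "m \<in> M" for m j
      using conj_base[OF pG, of m j] that Msub ps[of j] by auto
    have Mmul: "(m, 0) \<otimes>\<^bsub>G\<^esub> (m', 0) = (m \<otimes> m', 0)" if "m \<in> M" "m' \<in> M" for m m'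
      using that Msub by (auto simp: act_zero)
    have act: "\<phi> (d * j) m \<in> M" if "m \<in> M" for m j by (rule act_multiple[OF Msub inv that])
    have assoc: "(x \<otimes>\<^bsub>G\<^esub> y) \<otimes>\<^bsub>G\<^esub> (z \<otimes>\<^bsub>G\<^esub> u) = x \<otimes>\<^bsub>G\<^esub> ((y \<otimes>\<^bsub>G\<^esub> z) \<otimes>\<^bsub>G\<^esub> u)"
      "x \<otimes>\<^bsub>G\<^esub> ((y \<otimes>\<^bsub>G\<^esub> z) \<otimes>\<^bsub>G\<^esub> u) = (x \<otimes>\<^bsub>G\<^esub> y) \<otimes>\<^bsub>G\<^esub> (z \<otimes>\<^bsub>G\<^esub> u)"
      if "x \<in> carrier G" "y \<in> carrier G" "z \<in> carrier G" "u \<in> carrier G" for x y z u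
      using that by (simp_all add: G.m_assoc del: G_simps)
    have Hsub: "subgroup H G"
    proof (rule G.subgroupI)
      show "H \<subseteq> carrier G" using MG pG by (auto simp: H_def simp del: G_simps)
      show "H \<noteq> {}" using HI[OF subgroup.one_closed[OF M]] by blast
    next
      fix h assume "h \<in> H"
      then obtain m j where h: "h = (m, 0) \<otimes>\<^bsub>G\<^esub> ?p j" "m \<in> M" by (auto simp: H_def)
      have im: "inv m \<in> M" using subgroup.m_inv_closed[OF M h(2)] .
      have "inv\<^bsub>G\<^esub> h = ?p (- j) \<otimes>\<^bsub>G\<^esub> (inv m, 0)"
        unfolding h(1) G.inv_mult_group[OF MG[OF h(2)] pG] G.int_pow_neg[OF wG]
        using inv_base[of m] h(2) Msub by auto
      also have "\<dots> = (\<phi> (d * - j) (inv m), 0) \<otimes>\<^bsub>G\<^esub> ?p (- j)" by (rule move[OF im])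
      finally show "inv\<^bsub>G\<^esub> h \<in> H" using HI[OF act[OF im]] by metis
    next
      fix h h' assume "h \<in> H" "h' \<in> H"
      then obtain m j m' j' where h: "h = (m, 0) \<otimes>\<^bsub>G\<^esub> ?p j" "m \<in> M" "h' = (m', 0) \<otimes>\<^bsub>G\<^esub> ?p j'" "m' \<in> M"
        by (auto simp: H_def)
      let ?n = "\<phi> (d * j) m'"
      have n: "?n \<in> M" by (rule act[OF h(4)])
      have "h \<otimes>\<^bsub>G\<^esub> h' = (m, 0) \<otimes>\<^bsub>G\<^esub> ((?p j \<otimes>\<^bsub>G\<^esub> (m', 0)) \<otimes>\<^bsub>G\<^esub> ?p j')"
        unfolding h(1,3) by (rule assoc(1)[OF MG[OF h(2)] pG MG[OF h(4)] pG])
      also have "\<dots> = ((m, 0) \<otimes>\<^bsub>G\<^esub> (?n, 0)) \<otimes>\<^bsub>G\<^esub> (?p j \<otimes>\<^bsub>G\<^esub> ?p j')"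
        unfolding move[OF h(4)] by (rule assoc(2)[OF MG[OF h(2)] MG[OF n] pG pG])
      also have "\<dots> = (m \<otimes> ?n, 0) \<otimes>\<^bsub>G\<^esub> ?p (j + j')"
        unfolding Mmul[OF h(2) n] by (simp only: G.int_pow_mult[OF wG])
      finally show "h \<otimes>\<^bsub>G\<^esub> h' \<in> H" using HI[OF subgroup.m_closed[OF M h(2) n]] by simp
    qed
    have baseH: "base H = M"
    proof (intro equalityI subsetI)
      fix a assume "a \<in> base H"
      then have "(a, 0) \<in> H" by (simp add: base_def)
      then obtain m j where mj: "(a, 0) = (m, 0) \<otimes>\<^bsub>G\<^esub> ?p j" "m \<in> M" by (auto simp: H_def simp del: G_simps)
      \<comment> \<open>As \<open>d\<close> is positive, the integer component reveals the exponent,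
        so nothing beyond \<open>M\<close> lies over 0.\<close>
      from arg_cong[OF mj(1), of snd] have "d * j = 0" using ps[of j] by simp
      then have "j = 0" using d by simp
      then show "a \<in> M" using mj Msub act_zero by auto
    next
      fix m assume m: "m \<in> M"
      then have "(m, 0) = (m, 0) \<otimes>\<^bsub>G\<^esub> ?p 0" using Msub by (auto simp: act_zero)
      then show "m \<in> base H" using HI[OF m, of 0] m Msub by (auto simp: base_def simp del: G_simps)
    qed
    have sndH: "snd ` H = range (\<lambda>j. d * j)"
    proof (intro equalityI subsetI)
      fix x assume "x \<in> range (\<lambda>j. d * j)"
      then obtain j where "x = d * j" by blast
      then have "x = snd ((\<one>, 0) \<otimes>\<^bsub>G\<^esub> ?p j)" using ps[of j] by simp
      then show "x \<in> snd ` H" using HI[OF subgroup.one_closed[OF M], of j] by blast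
    next
      fix x assume "x \<in> snd ` H"
      then obtain m j where "x = snd ((m, 0) \<otimes>\<^bsub>G\<^esub> ?p j)" by (auto simp: H_def)
      then have "x = d * j" using ps[of j] by simp
      then show "x \<in> range (\<lambda>j. d * j)" by blast
    qed
    have "?w = (\<one>, 0) \<otimes>\<^bsub>G\<^esub> ?p 1"
      unfolding G.int_pow_1[OF wG] using v by (simp add: act_zero)
    then have "?w \<in> H" using HI[OF subgroup.one_closed[OF M], of 1] by simp
    then have "?\<Psi> H = C" unfolding C by (rule slice[OF Hsub baseH])
    moreover have "H \<in> F" using Hsub baseH sndH by (simp add: F_def)
    ultimately show "C \<in> ?\<Psi> ` F" by blast
  qed
qed

text \<open>For a subgroup over \<open>d\<close> with trace \<open>M\<close> the index
  \<open>m\<close> is \<open>d * [A : M]\<close>, which forces \<open>[A : M] = m div d\<close>. The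
  same number is the size of the fibre over \<open>(d, M)\<close> and so reappears as the
  factor.\<close>

theorem num_subgroups_semidirect_int:
  fixes m :: nat
  defines "I \<equiv> \<lambda>d e. {M. subgroup M A \<and> \<phi> (int d) ` M = M \<and> card (rcosets M) = e}"
  assumes m: "m > 0" and fin: "\<And>d. d dvd m \<Longrightarrow> finite (I d (m div d))"
  shows "num_subgroups (semidirect_product A integer_group \<phi>) m = (\<Sum>d | d dvd m. card (I d (m div d)) * (m div d))"
proof -
  define F where "F = (\<lambda>(d::nat, M). {H. subgroup H G \<and> base H = M \<and> snd ` H = range (\<lambda>j. int d * j)})"
  define T where "T = (SIGMA d:{d. d dvd m}. I d (m div d))"
  let ?S = "{H. subgroup H G \<and> card (rcosets\<^bsub>G\<^esub> H) = m}"
  have dpos: "0 < d" "0 < m div d" if "d dvd m" for d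
    using that m by (auto intro: Nat.gr0I dest: dvd_div_eq_0_iff[THEN iffD1])
  have fin_div: "finite {d. d dvd m}" using m by simp
  have finT: "finite T" unfolding T_def by (intro finite_SigmaI fin_div fin) simp
  have cardF: "finite (F (d, M)) \<and> card (F (d, M)) = m div d" if "(d, M) \<in> T" for d M
  proof -
    have M: "d dvd m" "subgroup M A" "\<phi> (int d) ` M = M" "card (rcosets M) = m div d"
      using that by (auto simp: T_def I_def)
    have "card (F (d, M)) = m div d"
      using bij_betw_same_card[OF bij_betw_subgroups_fibre[OF M(2,3)]] dpos(1)[OF M(1)] M(4)
      by (simp add: F_def)
    then show ?thesis using dpos(2)[OF M(1)] card_ge_0_finite by metis
  qed
  have S: "?S = (\<Union>x\<in>T. F x)"
  proof (intro equalityI subsetI)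
    fix H assume "H \<in> ?S"
    then have H: "subgroup H G" and idx: "card (rcosets (base H)) * card (rcosets\<^bsub>integer_group\<^esub> (snd ` H)) = m"
      using card_rcosets_G by auto
    have "subgroup (snd ` H) integer_group" by (rule group_hom.subgroup_img_is_subgroup[OF hom_snd H])
    moreover have "card (rcosets\<^bsub>integer_group\<^esub> (snd ` H)) > 0" using idx m by (metis mult_is_0 not_gr_zero)
    ultimately obtain d where d: "d > 0" "snd ` H = range (\<lambda>j. int d * j)" by (rule int_subgroup_cases)
    have prod: "card (rcosets (base H)) * d = m" using idx d card_rcosets_multiples by simp
    then have "d dvd m" and "card (rcosets (base H)) = m div d" using d(1) by auto
    moreover have "\<phi> (int d) ` base H = base H"
    proof -
      have "int d * 1 \<in> snd ` H" unfolding d(2) by blast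
      then obtain g where "g \<in> H" "snd g = int d" by auto
      then show ?thesis using act_base[OF H] by metis
    qed
    ultimately have "(d, base H) \<in> T" using subgroup_base[OF H] by (simp add: T_def I_def)
    moreover have "H \<in> F (d, base H)" using H d by (simp add: F_def)
    ultimately show "H \<in> (\<Union>x\<in>T. F x)" by blast
  next
    fix H assume "H \<in> (\<Union>x\<in>T. F x)"
    then obtain d M where T: "(d, M) \<in> T" and H: "H \<in> F (d, M)" by auto
    then have "d dvd m" "card (rcosets M) = m div d" by (auto simp: T_def I_def)
    moreover have "subgroup H G" "base H = M" "snd ` H = range (\<lambda>j. int d * j)" using H by (auto simp: F_def)
    ultimately show "H \<in> ?S"
      using card_rcosets_G[of H] card_rcosets_multiples[OF dpos(1)] by simp
  qed
  \<comment> \<open>The positive generator \<open>d\<close> is recovered from its set of multiples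
    by divisibility in both directions.\<close>
  have disj: "\<forall>x\<in>T. \<forall>y\<in>T. x \<noteq> y \<longrightarrow> F x \<inter> F y = {}"
  proof (intro ballI impI, rule ccontr)
    fix x y assume xy: "x \<in> T" "y \<in> T" "x \<noteq> y" "F x \<inter> F y \<noteq> {}"
    obtain d M e N where [simp]: "x = (d, M)" "y = (e, N)" by (cases x, cases y) auto
    from xy(4) obtain H where "H \<in> F x" "H \<in> F y" by blast
    then have "M = N" and r: "range (\<lambda>j. int d * j) = range (\<lambda>j. int e * j)" by (auto simp: F_def)
    have "int d * 1 \<in> range (\<lambda>j. int e * j)" unfolding r[symmetric] by blast
    then have "int e dvd int d" by (metis dvd_triv_left imageE mult.right_neutral)
    moreover have "int e * 1 \<in> range (\<lambda>j. int d * j)" unfolding r by blast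
    then have "int d dvd int e" by (metis dvd_triv_left imageE mult.right_neutral)
    ultimately have "d = e" by (simp add: dvd_antisym)
    then show False using \<open>M = N\<close> xy(3) by simp
  qed
  \<comment> \<open>The finiteness demanded by \<open>num_subgroups\<close> is implied by a positive
    \<open>card\<close>.\<close>
  have "num_subgroups (semidirect_product A integer_group \<phi>) m = card ?S"
    unfolding num_subgroups_def G_def[symmetric]
    by (rule arg_cong[where f = card]) (use m card_ge_0_finite in \<open>auto simp del: G_simps\<close>)
  also have "\<dots> = (\<Sum>x\<in>T. card (F x))"
    unfolding S by (rule card_UN_disjoint[OF finT _ disj]) (auto dest: cardF)
  also have "\<dots> = (\<Sum>x\<in>T. m div fst x)"
    by (rule sum.cong) (auto dest: cardF)
  also have "\<dots> = (\<Sum>d | d dvd m. \<Sum>x\<in>I d (m div d). m div d)"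
    unfolding T_def by (subst sum.Sigma) (auto intro!: fin_div fin sum.cong)
  finally show ?thesis by simp
qed

end

section \<open>Dimensions of quotients\<close>

text \<open>Coordinates with respect to a basis count the vectors. Conversely a finite space is its
  own finite spanning set, and its cardinality determines the exponent.\<close>

lemma has_dimension_iff_card:
  assumes "vectorspace (class_ring :: 'k::{field, finite} ring) W"
  shows "has_dimension (class_ring :: 'k ring) W t \<longleftrightarrow> card (carrier W) = CARD('k) ^ t"
proof -
  interpret vectorspace "class_ring :: 'k ring" W by fact
  have card_dim: "card (carrier W) = CARD('k) ^ dim" if fd: fin_dim
  proof -
    obtain B where B: "finite B" "basis B" using finite_basis_exists[OF fd] by blast
    have BW: "B \<subseteq> carrier W" using B(2) by (simp add: basis_def)
    have *: "\<forall>v. v \<in> carrier W \<longrightarrow> (\<exists>!a. a \<in> B \<rightarrow>\<^sub>E (UNIV :: 'k set) \<and> lincomb a B = v)"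
      using basis_criterion[OF B(1) BW] B(2) by simp
    \<comment> \<open>Extensional coefficient functions take a fixed value outside \<open>B\<close>,
      which makes the coefficients of a vector unique as functions.\<close>
    have "bij_betw (\<lambda>a. lincomb a B) (B \<rightarrow>\<^sub>E (UNIV :: 'k set)) (carrier W)"
    proof (rule bij_betw_imageI)
      have closed: "lincomb a B \<in> carrier W" for a
        by (rule lincomb_closed[OF BW]) simp
      show "inj_on (\<lambda>a. lincomb a B) (B \<rightarrow>\<^sub>E (UNIV :: 'k set))"
        using * closed unfolding inj_on_def by blast
      show "(\<lambda>a. lincomb a B) ` (B \<rightarrow>\<^sub>E (UNIV :: 'k set)) = carrier W"
        using * closed by (auto simp: image_iff)
    qed
    from bij_betw_same_card[OF this] show ?thesis
      using dim_basis[OF B] B(1) by (simp add: card_PiE)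
  qed
  show ?thesis
  proof
    assume "has_dimension (class_ring :: 'k ring) W t"
    then show "card (carrier W) = CARD('k) ^ t" using card_dim by (simp add: has_dimension_def)
  next
    assume c: "card (carrier W) = CARD('k) ^ t"
    then have "card (carrier W) > 0" by simp
    then have fin: "finite (carrier W)" by (rule card_ge_0_finite)
    have "span (carrier W) = carrier W"
      using span_is_subset2[of "carrier W"] in_own_span[of "carrier W"] by blast
    then have fd: fin_dim unfolding fin_dim_def using fin by blast
    then have "CARD('k) ^ dim = CARD('k) ^ t" using card_dim c by simp
    then have "dim = t" using card_field_gt_1[where ?'k='k] by (simp add: power_inject_exp)
    then show "has_dimension (class_ring :: 'k ring) W t" using fd by (simp add: has_dimension_def)
  qed
qed

text \<open>Negatives are multiples by minus one. In this form the transport and counting lemmas for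
  subgroups apply to submodules.\<close>

lemma submodule_iff:
  assumes "Module.module R V"
  shows "submodule R M V \<longleftrightarrow>
    subgroup M (add_monoid V) \<and> (\<forall>c\<in>carrier R. \<forall>v\<in>M. c \<odot>\<^bsub>V\<^esub> v \<in> M)"
proof -
  interpret Module.module R V by fact
  show ?thesis
  proof
    assume S: "submodule R M V"
    then have sub: "M \<subseteq> carrier V" "\<zero>\<^bsub>V\<^esub> \<in> M" "\<And>v w. v \<in> M \<Longrightarrow> w \<in> M \<Longrightarrow> v \<oplus>\<^bsub>V\<^esub> w \<in> M"
      "\<And>c v. c \<in> carrier R \<Longrightarrow> v \<in> M \<Longrightarrow> c \<odot>\<^bsub>V\<^esub> v \<in> M"
      by (auto simp: submodule_def)
    have "\<ominus>\<^bsub>V\<^esub> v \<in> M" if "v \<in> M" for v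
    proof -
      have "v \<in> carrier V" using that sub(1) by blast
      then have "\<ominus>\<^bsub>V\<^esub> v = (\<ominus>\<^bsub>R\<^esub> \<one>\<^bsub>R\<^esub>) \<odot>\<^bsub>V\<^esub> v" by (simp add: smult_l_minus)
      also have "\<dots> \<in> M" by (rule sub(4)[OF _ that]) simp
      finally show ?thesis .
    qed
    then have "subgroup M (add_monoid V)"
      using sub by (intro subgroup.intro) (auto simp: a_inv_def)
    then show "subgroup M (add_monoid V) \<and> (\<forall>c\<in>carrier R. \<forall>v\<in>M. c \<odot>\<^bsub>V\<^esub> v \<in> M)"
      using sub by blast
  next
    assume S: "subgroup M (add_monoid V) \<and> (\<forall>c\<in>carrier R. \<forall>v\<in>M. c \<odot>\<^bsub>V\<^esub> v \<in> M)"
    then have "subgroup M (add_monoid V)" by blast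
    from subgroup.subset[OF this] subgroup.one_closed[OF this] subgroup.m_closed[OF this] S
    show "submodule R M V" by (simp add: submodule_def module_axioms)
  qed
qed

text \<open>In the application \<open>h\<close> embeds the prime field as the constant Laurent
  polynomials; restricting along it gives the space whose dimension \<open>num_submodules\<close>
  prescribes.\<close>

lemma vectorspace_quotient:
  assumes V: "Module.module R V" and M: "submodule R M V" and K: "field K" and h: "h \<in> Ring.ring_hom K R"
  shows "vectorspace K (restrict_scalars h (quotient_module V M))" (is "vectorspace K ?W")
proof -
  interpret Module.module R V by fact
  interpret K: field K by fact
  have sg: "subgroup M (add_monoid V)" and scl: "\<And>c v. c \<in> carrier R \<Longrightarrow> v \<in> M \<Longrightarrow> c \<odot>\<^bsub>V\<^esub> v \<in> M"
    using M submodule_iff[OF V] by auto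
  interpret abelian_subgroup M V
    by (intro abelian_subgroupI3 additive_subgroupI sg) unfold_locales
  \<comment> \<open>All cosets in the union of \<open>quotient_module\<close> coincide, because
    multiplying by \<open>c\<close> sends \<open>M\<close> into \<open>M\<close>.\<close>
  have smult: "(\<Union>v\<in>M +>\<^bsub>V\<^esub> x. M +>\<^bsub>V\<^esub> (c \<odot>\<^bsub>V\<^esub> v)) = M +>\<^bsub>V\<^esub> (c \<odot>\<^bsub>V\<^esub> x)"
    if c: "c \<in> carrier R" and x: "x \<in> carrier V" for c x
  proof -
    have "M +>\<^bsub>V\<^esub> (c \<odot>\<^bsub>V\<^esub> v) = M +>\<^bsub>V\<^esub> (c \<odot>\<^bsub>V\<^esub> x)" if "v \<in> M +>\<^bsub>V\<^esub> x" for v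
    proof -
      from that obtain m where m: "m \<in> M" "v = m \<oplus>\<^bsub>V\<^esub> x" by (auto simp: a_r_coset_def')
      then have "c \<odot>\<^bsub>V\<^esub> v = (c \<odot>\<^bsub>V\<^esub> m) \<oplus>\<^bsub>V\<^esub> (c \<odot>\<^bsub>V\<^esub> x)"
        using c x a_subset by (auto intro: smult_r_distr)
      then have "c \<odot>\<^bsub>V\<^esub> v \<in> M +>\<^bsub>V\<^esub> (c \<odot>\<^bsub>V\<^esub> x)"
        using scl[OF c m(1)] by (auto simp: a_r_coset_def')
      then show ?thesis using a_repr_independence[OF _ _ sg] c x by simp
    qed
    moreover have "x \<in> M +>\<^bsub>V\<^esub> x" by (rule a_rcos_self[OF x])
    ultimately show ?thesis by blast
  qed
  have carrier: "carrier ?W = (\<lambda>x. M +>\<^bsub>V\<^esub> x) ` carrier V"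
    by (auto simp: restrict_scalars_def quotient_module_def A_RCOSETS_def')
  have zero: "\<zero>\<^bsub>?W\<^esub> = M +>\<^bsub>V\<^esub> \<zero>\<^bsub>V\<^esub>"
    using a_subset by (simp add: restrict_scalars_def quotient_module_def)
  have add: "(M +>\<^bsub>V\<^esub> x) \<oplus>\<^bsub>?W\<^esub> (M +>\<^bsub>V\<^esub> y) = M +>\<^bsub>V\<^esub> (x \<oplus>\<^bsub>V\<^esub> y)"
    if "x \<in> carrier V" "y \<in> carrier V" for x y
    using a_rcos_sum[OF that] by (simp add: restrict_scalars_def quotient_module_def)
  have sc: "c \<odot>\<^bsub>?W\<^esub> (M +>\<^bsub>V\<^esub> x) = M +>\<^bsub>V\<^esub> (h c \<odot>\<^bsub>V\<^esub> x)"
    if "c \<in> carrier K" "x \<in> carrier V" for c x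
    using smult[of "h c" x] that ring_hom_closed[OF h] by (simp add: restrict_scalars_def quotient_module_def)
  note hc = ring_hom_closed[OF h]
  show ?thesis
  proof (rule vs_criteria[OF K])
    show "\<forall>v\<in>carrier ?W. \<exists>neg_v\<in>carrier ?W. v \<oplus>\<^bsub>?W\<^esub> neg_v = \<zero>\<^bsub>?W\<^esub>"
    proof
      fix v assume "v \<in> carrier ?W"
      then obtain x where x: "x \<in> carrier V" "v = M +>\<^bsub>V\<^esub> x" by (auto simp: carrier)
      then show "\<exists>neg_v\<in>carrier ?W. v \<oplus>\<^bsub>?W\<^esub> neg_v = \<zero>\<^bsub>?W\<^esub>"
        by (intro bexI[of _ "M +>\<^bsub>V\<^esub> (\<ominus>\<^bsub>V\<^esub> x)"]) (auto simp: carrier zero add M.r_neg)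
    qed
  qed (auto simp: carrier zero add sc hc M.a_ac ring_hom_mult[OF h] ring_hom_add[OF h] ring_hom_one[OF h]
      smult_assoc1 smult_l_distr smult_r_distr)
qed

definition coords :: "nat \<Rightarrow> 'r::comm_ring_1 vec \<Rightarrow> nat \<Rightarrow> 'r"
  where "coords k v = (\<lambda>i. if i < k then v $ i else 0)"

lemma coords_iso:
  "coords k \<in> iso (add_monoid (module_vec TYPE('r::comm_ring_1) k)) (add_group (coord_space k))"
proof -
  have "bij_betw (coords k) (carrier_vec k) (coord_space k :: (nat \<Rightarrow> 'r) set)"
    by (rule bij_betwI[of _ _ _ "vec k"])
      (auto simp: coords_def coord_space_def fun_eq_iff intro!: eq_vecI)
  then show ?thesis
    by (auto simp: iso_def hom_def module_vec_simps coords_def coord_space_def fun_eq_iff)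
qed

text \<open>The bridge from the notions of the statement to the coordinate model: dimension
  \<open>t\<close> of the quotient means \<open>CARD('p) ^ t\<close> cosets, and
  \<open>coords\<close> transports subgroups together with their scalar action and index.\<close>

lemma num_submodules_eq:
  "num_submodules TYPE('p::prime_card) t k =
   card {M \<in> coord_submodules k :: (nat \<Rightarrow> 'p laurent) set set. add_index (coord_space k) M = CARD('p) ^ t}"
proof -
  interpret vec_module "TYPE('p laurent)" k .
  let ?V = "laurent_space TYPE('p) k" and ?R = "class_ring :: 'p laurent ring"
  let ?G = "add_monoid ?V" and ?K = "class_ring :: 'p mod_ring ring"
  have module: "Module.module ?R ?V" ..
  have G: "group ?G" by (rule abelian_group.a_group) unfold_locales
  have h: "Poly_Mapping.single 0 \<in> Ring.ring_hom ?K ?R"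
    by (rule ring_hom_memI) (auto simp: mult_single single_add)
  have "num_submodules TYPE('p) t k =
    card {M. subgroup M ?G \<and> ((\<forall>r. \<forall>v\<in>M. r \<cdot>\<^sub>v v \<in> M) \<and> card (rcosets\<^bsub>?G\<^esub> M) = CARD('p) ^ t)}"
    unfolding num_submodules_def
  proof (rule arg_cong[where f = card], rule Collect_cong)
    fix M
    show "(submodule ?R M ?V \<and> has_dimension ?K (restrict_scalars (Poly_Mapping.single 0) (quotient_module ?V M)) t)
       \<longleftrightarrow> subgroup M ?G \<and> (\<forall>r. \<forall>v\<in>M. r \<cdot>\<^sub>v v \<in> M) \<and> card (rcosets\<^bsub>?G\<^esub> M) = CARD('p) ^ t"
    proof (cases "submodule ?R M ?V")
      case True
      have "has_dimension ?K (restrict_scalars (Poly_Mapping.single 0) (quotient_module ?V M)) t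
        \<longleftrightarrow> card (carrier (restrict_scalars (Poly_Mapping.single (0::int)) (quotient_module ?V M))) = CARD('p mod_ring) ^ t"
        by (rule has_dimension_iff_card[OF vectorspace_quotient[OF module True class_field h]])
      also have "carrier (restrict_scalars (Poly_Mapping.single (0::int)) (quotient_module ?V M)) = rcosets\<^bsub>?G\<^esub> M"
        by (simp add: restrict_scalars_def quotient_module_def A_RCOSETS_def)
      finally show ?thesis using True submodule_iff[OF module, of M] by (simp add: module_vec_simps)
    next
      case False
      then show ?thesis using submodule_iff[OF module, of M] by (auto simp: module_vec_simps)
    qed
  qed
  also have "\<dots> = card {M. subgroup M (add_group (coord_space k) :: (nat \<Rightarrow> 'p laurent) monoid) \<and>
      ((\<forall>r. \<forall>f\<in>M. scale r f \<in> M) \<and> add_index (coord_space k) M = CARD('p) ^ t)}"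
  proof (rule bij_betw_same_card, rule bij_betw_subgroups_iso[OF coords_iso G group_add_group[OF add_closed_coord_space]])
    fix M assume M: "subgroup M ?G"
    then have Mc: "M \<subseteq> carrier_vec k" using subgroup.subset[OF M] by (simp add: module_vec_simps)
    have sc: "scale r (coords k v) = coords k (r \<cdot>\<^sub>v v)" if "v \<in> carrier_vec k" for r v
      using that by (auto simp: scale_def coords_def fun_eq_iff)
    have inj: "inj_on (coords k) (carrier_vec k :: 'p laurent vec set)"
      using coords_iso[of k, where ?'r = "'p laurent"] by (simp add: iso_def bij_betw_def module_vec_simps)
    have "(\<forall>r. \<forall>v\<in>M. r \<cdot>\<^sub>v v \<in> M) \<longleftrightarrow> (\<forall>r. \<forall>f\<in>coords k ` M. scale r f \<in> coords k ` M)"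
    proof -
      have "r \<cdot>\<^sub>v v \<in> M \<longleftrightarrow> scale r (coords k v) \<in> coords k ` M" if "v \<in> M" for r v
      proof -
        have v: "v \<in> carrier_vec k" using that Mc by blast
        show ?thesis unfolding sc[OF v] by (subst inj_on_image_mem_iff[OF inj _ Mc]) (use v in auto)
      qed
      then show ?thesis by blast
    qed
    moreover have "add_index (coord_space k) (coords k ` M) = card (rcosets\<^bsub>?G\<^esub> M)"
      by (rule card_rcosets_iso[OF coords_iso subgroup.subset[OF M] G])
    ultimately show "(\<forall>r. \<forall>v\<in>M. r \<cdot>\<^sub>v v \<in> M) \<and> card (rcosets\<^bsub>?G\<^esub> M) = CARD('p) ^ t \<longleftrightarrow>
      (\<forall>r. \<forall>f\<in>coords k ` M. scale r f \<in> coords k ` M) \<and> add_index (coord_space k) (coords k ` M) = CARD('p) ^ t"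
      by simp
  qed
  finally show ?thesis
    by (simp add: coord_submodules_def subgroup_add_group add_closed_coord_space conj_assoc)
qed

section \<open>The lamplighter group\<close>

text \<open>Scalars from the prime field act through repeated addition, so invariance under multiplication by
  \<open>x\<close> suffices.\<close>

lemma scale_invariant_iff:
  fixes M :: "(nat \<Rightarrow> 'p::prime_card laurent) set"
  assumes M: "add_closed M"
  shows "(\<forall>r. \<forall>f\<in>M. scale r f \<in> M) \<longleftrightarrow> scale (xpow 1) ` M = M"
proof
  assume closed: "\<forall>r. \<forall>f\<in>M. scale r f \<in> M"
  show "scale (xpow 1) ` M = M"
  proof (intro equalityI subsetI)
    fix f assume f: "f \<in> M"
    have "f = scale (xpow 1) (scale (xpow (- 1)) f)"
      by (simp add: scale_scale mult_single scale_one)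
    then show "f \<in> scale (xpow 1) ` M" using closed f by blast
  qed (use closed in auto)
next
  assume inv: "scale (xpow 1) ` M = M"
  have up: "scale (xpow 1) f \<in> M" if "f \<in> M" for f
    using imageI[OF that, of "scale (xpow 1)"] unfolding inv .
  have down: "scale (xpow (- 1)) f \<in> M" if f: "f \<in> M" for f
  proof -
    from f have "f \<in> scale (xpow 1) ` M" unfolding inv .
    then obtain g where g: "f = scale (xpow 1) g" "g \<in> M" by (rule imageE)
    then have "scale (xpow (- 1)) f = g" by (simp add: scale_scale mult_single scale_one)
    then show ?thesis using g(2) by simp
  qed
  have down_n: "scale (xpow (- int n)) f \<in> M" if f: "f \<in> M" for n f
  proof (induction n)
    case 0
    then show ?case using f by (simp add: scale_one)
  next
    case (Suc n)
    have "scale (xpow (- 1)) (scale (xpow (- int n)) f) = scale (xpow (- int (Suc n))) f"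
      by (simp add: scale_scale mult_single)
    then show ?case using down[OF Suc] by simp
  qed
  have const: "scale (of_nat m) f \<in> M" if f: "f \<in> M" for m f
  proof (induction m)
    case 0
    then show ?case using add_closedD(1)[OF M] by (simp add: scale_zero_left zero_fun_def)
  next
    case (Suc m)
    then show ?case using add_closedD(4)[OF M f Suc] by (simp add: scale_add_left scale_one plus_fun_def)
  qed
  have const': "scale (Poly_Mapping.single 0 c) f \<in> M" if f: "f \<in> M" for c f
  proof -
    have "c = of_nat (nat (to_int_mod_ring c))"
    proof -
      have "0 \<le> to_int_mod_ring c" using range_to_int_mod_ring[where ?'a='p] by (metis atLeastLessThan_iff rangeI)
      then show ?thesis by (simp add: of_nat_of_int_mod_ring)
    qed
    then have "(Poly_Mapping.single 0 c :: 'p laurent) = of_nat (nat (to_int_mod_ring c))"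
      by (metis single_of_nat)
    then show ?thesis using const[OF f] by simp
  qed
  have pol: "scale (laur q) f \<in> M" if f: "f \<in> M" for q f
    using f
  proof (induction q arbitrary: f)
    case 0
    then show ?case using add_closedD(1)[OF M] by (simp add: scale_zero_left zero_fun_def)
  next
    case (pCons c q)
    have eq: "scale (laur (pCons c q)) f = scale (Poly_Mapping.single 0 c) f + scale (xpow 1) (scale (laur q) f)"
      by (simp add: laur_pCons scale_add_left scale_scale)
    show ?case unfolding eq by (rule add_closedD(4)[OF M const'[OF pCons.prems] up[OF pCons.IH[OF pCons.prems]]])
  qed
  show "\<forall>r. \<forall>f\<in>M. scale r f \<in> M"
  proof (intro allI ballI)
    fix r :: "'p laurent" and f assume f: "f \<in> M"
    \<comment> \<open>Every scalar is a polynomial times a negative power of \<open>x\<close>, and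
      both factors have been dealt with.\<close>
    obtain n q where "xpow (int n) * r = laur q" by (rule xpow_mult_in_range_laur)
    then have "r = xpow (- int n) * laur q" by (metis xpow_cancel)
    then have "scale r f = scale (xpow (- int n)) (scale (laur q) f)" by (simp add: scale_scale)
    then show "scale r f \<in> M" using down_n[OF pol[OF f]] by simp
  qed
qed

definition lamp_base :: "nat \<Rightarrow> nat \<Rightarrow> (int \<Rightarrow> nat \<Rightarrow> int) monoid"
  where "lamp_base p n = sum_group UNIV (\<lambda>_. product_group {..<n} (\<lambda>_. integer_mod_group p))"

lemma lamp_base_simps:
  "carrier (lamp_base p n) = {x. (\<forall>z. x z \<in> {..<n} \<rightarrow>\<^sub>E carrier (integer_mod_group p)) \<and>
     finite {z. x z \<noteq> (\<lambda>i\<in>{..<n}. 0)}}"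
  "x \<otimes>\<^bsub>lamp_base p n\<^esub> y = (\<lambda>z. \<lambda>i\<in>{..<n}. (x z i + y z i) mod int p)"
  by (auto simp: lamp_base_def carrier_sum_group PiE_iff)

lemma comm_group_lamp_base: "comm_group (lamp_base p n)"
proof (rule group.group_comm_groupI)
  show "group (lamp_base p n)" by (simp add: lamp_base_def)
qed (auto simp: lamp_base_simps fun_eq_iff add.commute)

lemma int_action_lamp_base: "int_action (lamp_base p n) shift"
proof (intro int_action.intro int_action_axioms.intro comm_group_lamp_base)
  show "shift s \<in> hom (lamp_base p n) (lamp_base p n)" for s
  proof (rule homI)
    fix x assume x: "x \<in> carrier (lamp_base p n)"
    then have "finite ((\<lambda>z. z - s) -` {z. x z \<noteq> (\<lambda>i\<in>{..<n}. 0)})"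
      by (intro finite_vimageI) (simp_all add: lamp_base_simps inj_def)
    then show "shift s x \<in> carrier (lamp_base p n)"
      using x by (simp add: lamp_base_simps shift_def vimage_def)
  qed (simp add: lamp_base_simps shift_def)
qed (auto simp: shift_def fun_eq_iff algebra_simps)

section \<open>The lamplighter base as a module over the Laurent polynomials\<close>

lemma to_int_mod_ring_add:
  "to_int_mod_ring (a + b :: 'p::finite mod_ring) = (to_int_mod_ring a + to_int_mod_ring b) mod int CARD('p)"
  by (simp add: to_int_mod_ring.rep_eq plus_mod_ring.rep_eq)

text \<open>The base group as the module \<open>R ^ (n * d)\<close> on which \<open>x\<close> acts as the shift by \<open>d\<close>: the coordinate
  \<open>i * d + r\<close> collects the values at the lamps \<open>i\<close> of the positions congruent to \<open>r\<close> modulo \<open>d\<close>.\<close>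

definition lamp_coords :: "nat \<Rightarrow> nat \<Rightarrow> (nat \<Rightarrow> 'p::prime_card laurent) \<Rightarrow> int \<Rightarrow> nat \<Rightarrow> int"
  where "lamp_coords n d f =
    (\<lambda>z. \<lambda>i\<in>{..<n}. to_int_mod_ring (Poly_Mapping.lookup (f (i * d + nat (z mod int d))) (z div int d)))"

text \<open>Two divisions with remainder make the indices correspond: a position is
  \<open>r + j * d\<close>, a coordinate is \<open>i * d + r\<close>, with \<open>r < d\<close> in
  both, and \<open>j\<close> becomes the exponent of \<open>x\<close>.\<close>

lemma lamp_coords_iso:
  assumes d: "d > 0"
  shows "lamp_coords n d \<in> iso (add_group (coord_space (n * d) :: (nat \<Rightarrow> 'p::prime_card laurent) set)) (lamp_base CARD('p) n)"
proof -
  let ?C = "coord_space (n * d) :: (nat \<Rightarrow> 'p laurent) set" and ?p = "CARD('p)"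
  have ran: "to_int_mod_ring (c :: 'p mod_ring) \<in> {0..<int ?p}" for c
    using range_to_int_mod_ring[where ?'a='p] by blast
  have pos: "?p > 0" by simp
  have rec: "(int e mod int d + j * int d) div int d = j" "nat ((int e mod int d + j * int d) mod int d) = e mod d" for e j
    using d by (auto simp: nat_mod_distrib)
  have coord: "to_int_mod_ring (Poly_Mapping.lookup (f e) j) = lamp_coords n d f (int e mod int d + j * int d) (e div d)"
    if "e < n * d" for f :: "nat \<Rightarrow> 'p laurent" and e j
  proof -
    have "e div d < n" using that d by (simp add: less_mult_imp_div_less)
    then show ?thesis unfolding lamp_coords_def rec by simp
  qed
  have inj: "inj_on (lamp_coords n d) ?C"
  proof (rule inj_onI)
    fix f g :: "nat \<Rightarrow> 'p laurent"
    assume fg: "f \<in> ?C" "g \<in> ?C" "lamp_coords n d f = lamp_coords n d g"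
    show "f = g"
    proof
      fix e
      show "f e = g e"
      proof (cases "e < n * d")
        case True
        then have "to_int_mod_ring (Poly_Mapping.lookup (f e) j) = to_int_mod_ring (Poly_Mapping.lookup (g e) j)" for j
          using coord[of e] fg(3) by simp
        then show ?thesis by (intro poly_mapping_eqI) (metis of_int_mod_ring_to_int_mod_ring)
      next
        case False
        then show ?thesis using fg by (simp add: coord_space_def)
      qed
    qed
  qed
  have into: "lamp_coords n d f \<in> carrier (lamp_base ?p n)" for f :: "nat \<Rightarrow> 'p laurent"
  proof -
    \<comment> \<open>A position with a nonzero lamp comes from an exponent that occurs in one of
      the finitely many coordinates; this bounds the support.\<close>
    let ?S = "\<Union>e<n * d. (\<lambda>j. int e mod int d + j * int d) ` Poly_Mapping.keys (f e)"
    have "z \<in> ?S" if "lamp_coords n d f z \<noteq> (\<lambda>i\<in>{..<n}. 0)" for z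
    proof -
      from that obtain i where i: "i < n" "to_int_mod_ring (Poly_Mapping.lookup (f (i * d + nat (z mod int d))) (z div int d)) \<noteq> 0"
        by (auto simp: lamp_coords_def fun_eq_iff restrict_def split: if_splits)
      let ?e = "i * d + nat (z mod int d)"
      have r: "nat (z mod int d) < d" using d by (simp add: nat_less_iff)
      then have "?e < Suc i * d" by simp
      also have "\<dots> \<le> n * d" using i(1) by (intro mult_le_mono1) simp
      finally have "?e < n * d" .
      moreover have "int ?e mod int d = z mod int d" using d by simp
      then have "z = int ?e mod int d + (z div int d) * int d" by simp
      moreover have "z div int d \<in> Poly_Mapping.keys (f ?e)" using i(2) by (auto simp: in_keys_iff)
      ultimately show ?thesis by blast
    qed
    then have "{z. lamp_coords n d f z \<noteq> (\<lambda>i\<in>{..<n}. 0)} \<subseteq> ?S" by blast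
    moreover have "finite ?S" by (intro finite_UN_I finite_imageI) simp_all
    ultimately have "finite {z. lamp_coords n d f z \<noteq> (\<lambda>i\<in>{..<n}. 0)}" by (rule finite_subset)
    then show ?thesis
      using ran pos by (auto simp: lamp_base_simps carrier_integer_mod_group lamp_coords_def)
  qed
  have surj: "x \<in> lamp_coords n d ` ?C" if x: "x \<in> carrier (lamp_base ?p n)" for x
  proof -
    have xr: "x z i \<in> {0..<int ?p}" if "i < n" for z i
      using x that pos by (auto simp: lamp_base_simps carrier_integer_mod_group PiE_iff)
    \<comment> \<open>Elements of the base are extensional in the lamp index, and the restriction in
      \<open>lamp_coords\<close> produces the same default value.\<close>
    have xe: "x z i = undefined" if "\<not> i < n" for z i
      using x that by (auto simp: lamp_base_simps PiE_iff extensional_def)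
    have fin: "finite {z. x z \<noteq> (\<lambda>i\<in>{..<n}. 0)}" using x by (simp add: lamp_base_simps)
    \<comment> \<open>The inverse map: coordinate \<open>e\<close> belongs to the lamp
      \<open>e div d\<close> and the residue \<open>e mod d\<close>, and its coefficient at exponent
      \<open>j\<close> is read at position \<open>e mod d + j * d\<close>.\<close>
    define g :: "nat \<Rightarrow> int \<Rightarrow> 'p mod_ring"
      where "g e j = of_int_mod_ring (x (int e mod int d + j * int d) (e div d))" for e j
    define f where "f e = (if e < n * d then Abs_poly_mapping (g e) else 0)" for e
    have fing: "finite {j. g e j \<noteq> 0}" if "e < n * d" for e
    proof (rule finite_subset)
      have "e div d < n" using that d by (simp add: less_mult_imp_div_less)
      then show "{j. g e j \<noteq> 0} \<subseteq> (\<lambda>j. int e mod int d + j * int d) -` {z. x z \<noteq> (\<lambda>i\<in>{..<n}. 0)}"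
        by (auto simp: g_def)
      show "finite ((\<lambda>j. int e mod int d + j * int d) -` {z. x z \<noteq> (\<lambda>i\<in>{..<n}. 0)})"
        by (rule finite_vimageI[OF fin]) (use d in \<open>auto simp: inj_def\<close>)
    qed
    have fC: "f \<in> ?C" by (simp add: f_def coord_space_def)
    have "lamp_coords n d f z i = x z i" for z i
    proof (cases "i < n")
      case True
      let ?e = "i * d + nat (z mod int d)"
      have r: "nat (z mod int d) < d" using d by (simp add: nat_less_iff)
      then have "?e < Suc i * d" by simp
      also have "\<dots> \<le> n * d" using True by (intro mult_le_mono1) simp
      finally have e: "?e < n * d" .
      have "int ?e mod int d = z mod int d" using d by simp
      then have z: "int ?e mod int d + (z div int d) * int d = z" by simp
      have i: "?e div d = i" using r d by simp
      have "Poly_Mapping.lookup (f ?e) = g ?e"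
        using e fing[OF e] by (simp add: f_def Abs_poly_mapping_inverse)
      then have "lamp_coords n d f z i = to_int_mod_ring (g ?e (z div int d))"
        using True by (simp add: lamp_coords_def)
      also have "\<dots> = x z i"
        unfolding g_def z i using xr[OF True, of z] by simp
      finally show ?thesis .
    next
      case False
      then show ?thesis by (simp add: lamp_coords_def xe)
    qed
    then have "x = lamp_coords n d f" by (simp add: fun_eq_iff)
    then show ?thesis using fC by blast
  qed
  have "lamp_coords n d (f + g) = (\<lambda>z. \<lambda>i\<in>{..<n}. (lamp_coords n d f z i + lamp_coords n d g z i) mod int ?p)"
    for f g :: "nat \<Rightarrow> 'p laurent"
    by (auto simp: lamp_coords_def fun_eq_iff lookup_add to_int_mod_ring_add restrict_def)
  then show ?thesis
    using inj into surj by (auto simp: iso_def hom_def bij_betw_def lamp_base_simps(2))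
qed

text \<open>Going back by \<open>d\<close> positions lowers the quotient by one and keeps the
  residue, which matches the effect of multiplication by \<open>x\<close> on coefficients.\<close>

lemma lamp_coords_scale:
  assumes "d > 0"
  shows "lamp_coords n d (scale (xpow 1) f) = shift (int d) (lamp_coords n d f)"
proof -
  have "(z - int d) div int d = z div int d - 1" "(z - int d) mod int d = z mod int d" for z
    using assms div_mult_self1[of "int d" z "- 1"] mod_mult_self1[of z "- 1" "int d"] by simp_all
  then show ?thesis
    by (simp add: lamp_coords_def shift_def scale_def lookup_single_mult)
qed

text \<open>By \<open>scale_invariant_iff\<close> a submodule is a subgroup preserved by
  multiplication by \<open>x\<close>, and that multiplication becomes the shift by
  \<open>d\<close>.\<close>

lemma bij_betw_coord_submodules_lamp_base:
  assumes d: "d > 0"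
  shows "bij_betw ((`) (lamp_coords n d))
    {M \<in> coord_submodules (n * d) :: (nat \<Rightarrow> 'p::prime_card laurent) set set. add_index (coord_space (n * d)) M = e}
    {M. subgroup M (lamp_base CARD('p) n) \<and> shift (int d) ` M = M \<and> card (rcosets\<^bsub>lamp_base CARD('p) n\<^esub> M) = e}"
proof -
  let ?C = "coord_space (n * d) :: (nat \<Rightarrow> 'p laurent) set" and ?B = "lamp_base CARD('p) n" and ?\<psi> = "lamp_coords n d"
  note iso = lamp_coords_iso[OF d, of n, where ?'p='p]
  have G: "group (add_group ?C)" by (rule group_add_group[OF add_closed_coord_space])
  have "bij_betw ((`) ?\<psi>) {M. subgroup M (add_group ?C) \<and> (scale (xpow 1) ` M = M \<and> add_index ?C M = e)}
    {M. subgroup M ?B \<and> (shift (int d) ` M = M \<and> card (rcosets\<^bsub>?B\<^esub> M) = e)}"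
  proof (rule bij_betw_subgroups_iso[OF iso G comm_group.axioms(2)[OF comm_group_lamp_base]])
    fix M assume M: "subgroup M (add_group ?C)"
    then have MC: "M \<subseteq> ?C" using subgroup.subset by fastforce
    have sMC: "scale (xpow 1) ` M \<subseteq> ?C" using MC by (auto simp: coord_space_def scale_def)
    have inj: "inj_on ?\<psi> ?C" using iso by (simp add: iso_def bij_betw_def)
    have "shift (int d) ` ?\<psi> ` M = ?\<psi> ` scale (xpow 1) ` M"
      by (simp add: image_image lamp_coords_scale[OF d])
    then have "shift (int d) ` ?\<psi> ` M = ?\<psi> ` M \<longleftrightarrow> scale (xpow 1) ` M = M"
      using inj_on_image_eq_iff[OF inj sMC MC] by simp
    moreover have "card (rcosets\<^bsub>?B\<^esub> (?\<psi> ` M)) = add_index ?C M"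
      by (rule card_rcosets_iso[OF iso subgroup.subset[OF M] G])
    ultimately show "scale (xpow 1) ` M = M \<and> add_index ?C M = e \<longleftrightarrow>
      shift (int d) ` ?\<psi> ` M = ?\<psi> ` M \<and> card (rcosets\<^bsub>?B\<^esub> (?\<psi> ` M)) = e" by simp
  qed
  moreover have "{M. subgroup M (add_group ?C) \<and> (scale (xpow 1) ` M = M \<and> add_index ?C M = e)} =
    {M \<in> coord_submodules (n * d). add_index ?C M = e}"
    using scale_invariant_iff[where ?'p='p]
    by (auto simp: coord_submodules_def subgroup_add_group add_closed_coord_space)
  ultimately show ?thesis by simp
qed

theorem proposition3p9:
  fixes p n m :: nat
  assumes "p = CARD('p::prime_card)" and "n \<ge> 1" and "m \<ge> 1"
  shows "num_subgroups (lamplighter p n) m =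
           (\<Sum>t | p ^ t dvd m. num_submodules TYPE('p) t (n * m div p ^ t) * p ^ t) \<and>
         int (\<Sum>t | p ^ t dvd m. num_submodules TYPE('p) t (n * m div p ^ t) * p ^ t) =
           (\<Sum>t | 1 \<le> t \<and> p ^ t dvd m.
              (int p ^ (n * m * t div p ^ t) - int p ^ (n * m * (t - 1) div p ^ t)) * int p ^ t) + 1"
proof
  have p1: "p > 1" using assms(1) prime_card[where ?'a='p] prime_gt_1_nat by simp
  define S where "S k q = {M \<in> coord_submodules k :: (nat \<Rightarrow> 'p laurent) set set. add_index (coord_space k) M = q}" for k q
  note count = card_coord_submodules[where ?'k = "'p mod_ring", folded S_def, unfolded CARD_mod_ring assms(1)[symmetric]]
  have num: "num_submodules TYPE('p) t k = card (S k (p ^ t))" for t k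
    unfolding num_submodules_eq S_def assms(1) ..
  have dpos: "0 < d" "0 < m div d" if "d dvd m" for d
    using that assms(3) by (auto intro: Nat.gr0I dest: dvd_div_eq_0_iff[THEN iffD1])
  have fint: "finite {t. p ^ t dvd m}"
  proof (rule finite_subset)
    show "{t. p ^ t dvd m} \<subseteq> {..<m}"
    proof
      fix t assume "t \<in> {t. p ^ t dvd m}"
      then have "p ^ t \<le> m" using assms(3) by (simp add: dvd_imp_le)
      moreover have "t < p ^ t" using p1 by (simp add: power_gt_expt)
      ultimately show "t \<in> {..<m}" by simp
    qed
  qed simp
  interpret int_action "lamp_base p n" shift by (rule int_action_lamp_base)
  have bij: "bij_betw ((`) (lamp_coords n d)) (S (n * d) e)
      {M. subgroup M (lamp_base p n) \<and> shift (int d) ` M = M \<and> card (rcosets\<^bsub>lamp_base p n\<^esub> M) = e}" if "d > 0" for d e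
    using bij_betw_coord_submodules_lamp_base[OF that, where ?'p='p] unfolding S_def assms(1) .
  have "num_subgroups (lamplighter p n) m =
      (\<Sum>d | d dvd m. card {M. subgroup M (lamp_base p n) \<and> shift (int d) ` M = M \<and>
        card (rcosets\<^bsub>lamp_base p n\<^esub> M) = m div d} * (m div d))"
    unfolding lamplighter_def lamp_base_def[symmetric]
  proof (rule num_subgroups_semidirect_int)
    show "m > 0" using assms(3) by simp
    show "finite {M. subgroup M (lamp_base p n) \<and> shift (int d) ` M = M \<and>
        card (rcosets\<^bsub>lamp_base p n\<^esub> M) = m div d}" if "d dvd m" for d
      using bij_betw_finite[OF bij[OF dpos(1)[OF that]]] count[OF dpos(2)[OF that]] by blast
  qed
  also have "\<dots> = (\<Sum>d | d dvd m. card (S (n * d) (m div d)) * (m div d))"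
    by (intro sum.cong) (simp_all add: bij_betw_same_card[OF bij] dpos)
  \<comment> \<open>The summation passes from \<open>d\<close> to the index
    \<open>e = m div d\<close> of the trace in the base, an involution on the divisors of
    \<open>m\<close>.\<close>
  also have "\<dots> = (\<Sum>e | e dvd m. card (S (n * (m div e)) e) * e)"
    by (rule sum.reindex_bij_witness[of _ "\<lambda>e. m div e" "\<lambda>d. m div d"]) (use assms(3) in \<open>auto simp: div_div_eq_right\<close>)
  \<comment> \<open>No submodule has an index that is not a power of \<open>p\<close>, so the other
    divisors contribute 0.\<close>
  also have "\<dots> = (\<Sum>e\<in>(\<lambda>t. p ^ t) ` {t. p ^ t dvd m}. card (S (n * (m div e)) e) * e)"
  proof (rule sum.mono_neutral_right)
    show "finite {e. e dvd m}" using assms(3) by simp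
    show "\<forall>e\<in>{e. e dvd m} - (\<lambda>t. p ^ t) ` {t. p ^ t dvd m}. card (S (n * (m div e)) e) * e = 0"
    proof
      fix e assume e: "e \<in> {e. e dvd m} - (\<lambda>t. p ^ t) ` {t. p ^ t dvd m}"
      then have "S (n * (m div e)) e = {}" using count[OF dpos(1), of e] by blast
      then show "card (S (n * (m div e)) e) * e = 0" by simp
    qed
  qed auto
  also have "\<dots> = (\<Sum>t | p ^ t dvd m. card (S (n * (m div p ^ t)) (p ^ t)) * p ^ t)"
    using p1 by (subst sum.reindex) (auto simp: inj_on_def power_inject_exp)
  also have "\<dots> = (\<Sum>t | p ^ t dvd m. num_submodules TYPE('p) t (n * m div p ^ t) * p ^ t)"
    by (rule sum.cong) (auto simp: num div_mult_swap)
  finally show "num_subgroups (lamplighter p n) m =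
    (\<Sum>t | p ^ t dvd m. num_submodules TYPE('p) t (n * m div p ^ t) * p ^ t)" .
  have "int (\<Sum>t | p ^ t dvd m. num_submodules TYPE('p) t (n * m div p ^ t) * p ^ t) =
    (\<Sum>t | p ^ t dvd m. if t = 0 then 1 else
      (int p ^ (n * m * t div p ^ t) - int p ^ (n * m * (t - 1) div p ^ t)) * int p ^ t)"
    unfolding of_nat_sum
  proof (rule sum.cong)
    fix t assume "t \<in> {t. p ^ t dvd m}"
    then obtain c where c: "m = p ^ t * c" by (auto elim: dvdE)
    have pt: "p ^ t > 0" using p1 by simp
    \<comment> \<open>Since \<open>p ^ t\<close> divides \<open>m\<close>, all three divisions are
      exact and the exponents are those of rank \<open>n * c\<close>.\<close>
    have e: "n * m div p ^ t = n * c" "n * m * t div p ^ t = n * c * t" "n * m * (t - 1) div p ^ t = n * c * (t - 1)"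
      using pt by (simp_all add: c mult.left_commute[of n] mult.assoc)
    have "int (card (S (n * c) (p ^ t))) = (if t = 0 then 1 else int p ^ (n * c * t) - int p ^ (n * c * (t - 1)))"
      using count[OF pt] by blast
    then show "int (num_submodules TYPE('p) t (n * m div p ^ t) * p ^ t) = (if t = 0 then 1 else
      (int p ^ (n * m * t div p ^ t) - int p ^ (n * m * (t - 1) div p ^ t)) * int p ^ t)"
      unfolding e num by simp
  qed simp
  \<comment> \<open>The term \<open>t = 0\<close> stands for the whole module alone and becomes the
    summand 1 of the closed form.\<close>
  also have "\<dots> = 1 + (\<Sum>t\<in>{t. p ^ t dvd m} - {0}. if t = 0 then 1 else
      (int p ^ (n * m * t div p ^ t) - int p ^ (n * m * (t - 1) div p ^ t)) * int p ^ t)"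
    by (subst sum.remove[OF fint, of 0]) auto
  also have "\<dots> = 1 + (\<Sum>t | 1 \<le> t \<and> p ^ t dvd m.
      (int p ^ (n * m * t div p ^ t) - int p ^ (n * m * (t - 1) div p ^ t)) * int p ^ t)"
    by (intro arg_cong2[where f = "(+)"] sum.cong) auto
  finally show "int (\<Sum>t | p ^ t dvd m. num_submodules TYPE('p) t (n * m div p ^ t) * p ^ t) =
      (\<Sum>t | 1 \<le> t \<and> p ^ t dvd m.
        (int p ^ (n * m * t div p ^ t) - int p ^ (n * m * (t - 1) div p ^ t)) * int p ^ t) + 1"
    by simp
qed

end
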